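(* Let $n\ge3$ and let $\Omega\subset\mathbb{R}^n$ be a bounded domain with smooth mean convex boundary. Suppose that there is a point $q\in\partial\Omega$ such that $\partial\Omega$ is not convex at $q$, but has zero mean curvature at $q$. Then for any constant $0<\epsilon\le1$ there exists a vector-valued function $\psi=(\psi^1,\psi^2)\in C^2(\overline\Omega,\mathbb{R}^2)$ with $|D\psi^1|\le\epsilon$ such that the Dirichlet problem for the minimal surface system $$\sum_{i,j=1}^n g^{ij}\,\partial_{x_i}\partial_{x_j}u^\alpha=0\ \text{ in }\Omega,\qquad u^\alpha=\psi^\alpha\ \text{ on }\partial\Omega,\qquad\alpha=1,2,$$ where $(g^{ij})$ is the inverse matrix of $g_{ij}=\delta_{ij}+\sum_{\alpha=1}^2\partial_{x_i}u^\alpha\,\partial_{x_j}u^\alpha$, has no classical solution $u=(u^1,u^2)$.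
   Context: Principal curvatures of $\partial\Omega$ are taken with respect to the normal pointing into $\Omega$, so that they are nonnegative for convex $\Omega$; the mean curvature is their sum, and $\partial\Omega$ is mean convex if its mean curvature is nonnegative everywhere. "$\partial\Omega$ is not convex at $q$" means that some principal curvature of $\partial\Omega$ at $q$ is negative. A classical solution is a map $u$ that is $C^2$ in $\Omega$, continuous on $\overline\Omega$, and satisfies the system and boundary condition pointwise. *)

theory Defs
  imports "HOL-Analysis.Analysis"
begin

definition partial_deriv :: "'n::finite \<Rightarrow> (real^'n \<Rightarrow> 'b::real_normed_vector) \<Rightarrow> real^'n \<Rightarrow> 'b"
  where "partial_deriv i f x = frechet_derivative f (at x) (axis i 1)"

definition gradient :: "(real^'n::finite \<Rightarrow> real) \<Rightarrow> real^'n \<Rightarrow> real^'n"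
  where "gradient f x = (\<chi> i. partial_deriv i f x)"

text \<open>The class \<open>C\<^sup>k(S)\<close>; intended for open \<open>S\<close>, where \<open>differentiable_on\<close> is
  differentiability at every point of \<open>S\<close>.\<close>

primrec Ck_on :: "nat \<Rightarrow> (real^'n::finite) set \<Rightarrow> (real^'n \<Rightarrow> 'b::real_normed_vector) \<Rightarrow> bool"
  where
    "Ck_on 0 S f \<longleftrightarrow> continuous_on S f"
  | "Ck_on (Suc k) S f \<longleftrightarrow> f differentiable_on S \<and> (\<forall>i. Ck_on k S (partial_deriv i f))"

definition smooth_on :: "(real^'n::finite) set \<Rightarrow> (real^'n \<Rightarrow> 'b::real_normed_vector) \<Rightarrow> bool"
  where "smooth_on S f \<longleftrightarrow> (\<forall>k. Ck_on k S f)"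

definition extends_continuously :: "(real^'n::finite) set \<Rightarrow> (real^'n \<Rightarrow> 'b::real_normed_vector) \<Rightarrow> bool"
  where "extends_continuously \<Omega> f \<longleftrightarrow>
    (\<exists>g. continuous_on (closure \<Omega>) g \<and> (\<forall>x\<in>\<Omega>. g x = f x))"

text \<open>\<open>C\<^sup>2\<close> up to the boundary, in the usual sense of elliptic PDE theory: \<open>f\<close> is continuous on
  the closure, \<open>C\<^sup>2\<close> in the open set \<open>\<Omega>\<close>, and its derivatives of order one and two extend
  continuously from \<open>\<Omega>\<close> to the closure.\<close>

definition C2_closure :: "(real^'n::finite) set \<Rightarrow> (real^'n \<Rightarrow> 'b::real_normed_vector) \<Rightarrow> bool"
  where "C2_closure \<Omega> f \<longleftrightarrow>
    Ck_on 2 \<Omega> f \<and> continuous_on (closure \<Omega>) f \<and>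
    (\<forall>i. extends_continuously \<Omega> (partial_deriv i f)) \<and>
    (\<forall>i j. extends_continuously \<Omega> (partial_deriv i (partial_deriv j f)))"

text \<open>Near \<open>p\<close> the set \<open>\<Omega>\<close> is \<open>{r > 0}\<close> and its boundary is the regular level set \<open>{r = 0}\<close>, so
  that the gradient of \<open>r\<close> points into \<open>\<Omega>\<close>.\<close>

definition local_defining_function ::
    "(real^'n::finite) set \<Rightarrow> real^'n \<Rightarrow> (real^'n) set \<Rightarrow> (real^'n \<Rightarrow> real) \<Rightarrow> bool"
  where "local_defining_function \<Omega> p U r \<longleftrightarrow>
    open U \<and> p \<in> U \<and> smooth_on U r \<and> (\<forall>x\<in>U. gradient r x \<noteq> 0) \<and>
    \<Omega> \<inter> U = {x \<in> U. r x > 0} \<and> frontier \<Omega> \<inter> U = {x \<in> U. r x = 0}"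

definition smooth_boundary :: "(real^'n::finite) set \<Rightarrow> bool"
  where "smooth_boundary \<Omega> \<longleftrightarrow> (\<forall>p\<in>frontier \<Omega>. \<exists>U r. local_defining_function \<Omega> p U r)"

text \<open>The unit normal pointing into \<open>\<Omega>\<close> at a boundary point. It does not depend on the defining
  function; \<open>sgn\<close> normalizes a vector to length one.\<close>

definition inner_normal :: "(real^'n::finite) set \<Rightarrow> real^'n \<Rightarrow> real^'n"
  where "inner_normal \<Omega> p = (THE \<nu>. \<exists>U r. local_defining_function \<Omega> p U r \<and> \<nu> = sgn (gradient r p))"

definition boundary_tangent_space :: "(real^'n::finite) set \<Rightarrow> real^'n \<Rightarrow> (real^'n) set"
  where "boundary_tangent_space \<Omega> p = {v. v \<bullet> inner_normal \<Omega> p = 0}"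

text \<open>Eigenspaces and eigenvalues of the shape operator \<open>-d\<nu>\<close> on the tangent space, \<open>\<nu>\<close> being the
  inner unit normal. A derivative of \<open>\<nu>\<close> within the boundary is unique only on tangent vectors,
  and it is only applied to those. For a ball of radius \<open>R\<close> the only principal curvature is
  \<open>1/R\<close>.\<close>

definition principal_space :: "(real^'n::finite) set \<Rightarrow> real^'n \<Rightarrow> real \<Rightarrow> (real^'n) set"
  where "principal_space \<Omega> p \<kappa> =
    {v \<in> boundary_tangent_space \<Omega> p.
       \<exists>L. (inner_normal \<Omega> has_derivative L) (at p within frontier \<Omega>) \<and> - L v = \<kappa> *\<^sub>R v}"

definition principal_curvatures :: "(real^'n::finite) set \<Rightarrow> real^'n \<Rightarrow> real set"
  where "principal_curvatures \<Omega> p = {\<kappa>. \<exists>v\<in>principal_space \<Omega> p \<kappa>. v \<noteq> 0}"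

text \<open>The sum of the principal curvatures, each counted with its multiplicity.\<close>

definition mean_curvature :: "(real^'n::finite) set \<Rightarrow> real^'n \<Rightarrow> real"
  where "mean_curvature \<Omega> p =
    (\<Sum>\<kappa>\<in>principal_curvatures \<Omega> p. real (dim (principal_space \<Omega> p \<kappa>)) * \<kappa>)"

definition mean_convex_boundary :: "(real^'n::finite) set \<Rightarrow> bool"
  where "mean_convex_boundary \<Omega> \<longleftrightarrow> (\<forall>p\<in>frontier \<Omega>. mean_curvature \<Omega> p \<ge> 0)"

definition boundary_not_convex_at :: "(real^'n::finite) set \<Rightarrow> real^'n \<Rightarrow> bool"
  where "boundary_not_convex_at \<Omega> q \<longleftrightarrow> (\<exists>\<kappa>\<in>principal_curvatures \<Omega> q. \<kappa> < 0)"

definition graph_metric :: "(real^'n::finite \<Rightarrow> real^2) \<Rightarrow> real^'n \<Rightarrow> real^'n^'n"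
  where "graph_metric u x = (\<chi> i j. (if i = j then 1 else 0) +
    (\<Sum>\<alpha>\<in>UNIV. partial_deriv i (\<lambda>y. u y $ \<alpha>) x * partial_deriv j (\<lambda>y. u y $ \<alpha>) x))"

definition minimal_surface_system_on :: "(real^'n::finite) set \<Rightarrow> (real^'n \<Rightarrow> real^2) \<Rightarrow> bool"
  where "minimal_surface_system_on \<Omega> u \<longleftrightarrow>
    (\<forall>x\<in>\<Omega>. \<forall>\<alpha>. (\<Sum>i\<in>UNIV. \<Sum>j\<in>UNIV. matrix_inv (graph_metric u x) $ i $ j *
       partial_deriv i (partial_deriv j (\<lambda>y. u y $ \<alpha>)) x) = 0)"

definition classical_solution ::
    "(real^'n::finite) set \<Rightarrow> (real^'n \<Rightarrow> real^2) \<Rightarrow> (real^'n \<Rightarrow> real^2) \<Rightarrow> bool"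
  where "classical_solution \<Omega> \<psi> u \<longleftrightarrow>
    Ck_on 2 \<Omega> u \<and> continuous_on (closure \<Omega>) u \<and>
    minimal_surface_system_on \<Omega> u \<and> (\<forall>x\<in>frontier \<Omega>. u x = \<psi> x)"

end

theory Submission
  imports Defs
begin

text \<open>
  The boundary data are \<open>\<psi>\<^sup>1 = \<epsilon> e \<bullet> x\<close> and \<open>\<psi>\<^sup>2 = - k |x - q|\<^sup>2\<close>, where \<open>e\<close> is a principal direction at \<open>q\<close>
  with positive curvature; it exists because the principal curvatures at \<open>q\<close> sum to zero and one
  of them is negative. A linear function solves \<open>g\<^sup>i\<^sup>j \<partial>\<^sub>i \<partial>\<^sub>j f = 0\<close> for any coefficients, so the maximum
  principle forces \<open>u\<^sup>1 = \<epsilon> e \<bullet> x\<close>. Then \<open>u\<^sup>2\<close> solves the scalar minimal surface equation for the flat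
  metric \<open>I + \<epsilon>\<^sup>2 e e\<^sup>T\<close>. Stretching the direction \<open>e\<close> lowers the weight of a positive curvature, so in
  this metric the boundary has negative mean curvature near \<open>q\<close>, and the argument of Jenkins and
  Serrin applies: one barrier, with infinite slope on a small sphere around \<open>q\<close>, bounds \<open>u\<^sup>2\<close> away
  from \<open>q\<close> by the boundary values away from \<open>q\<close>; a second one, with infinite slope on level sets
  of the defining function, bounds \<open>u\<^sup>2 q\<close> by the values on that sphere. Both bounds hold up to additive
  constants independent of \<open>k\<close>, which is impossible for large \<open>k\<close>.
\<close>

section \<open>Self-adjoint operators and traces\<close>

definition orthonormal :: "'a::euclidean_space set \<Rightarrow> bool"
  where "orthonormal V \<longleftrightarrow> pairwise orthogonal V \<and> (\<forall>v\<in>V. norm v = 1)"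

lemma orthonormal_inner:
  assumes "orthonormal V" "v \<in> V" "w \<in> V"
  shows "v \<bullet> w = (if v = w then 1 else 0)"
  using assms unfolding orthonormal_def pairwise_def orthogonal_def
  by (auto simp: norm_eq_1)

lemma orthonormal_independent:
  assumes "orthonormal V"
  shows "independent V"
  using assms pairwise_orthogonal_independent[of V] unfolding orthonormal_def by force

lemma orthonormal_finite:
  assumes "orthonormal V"
  shows "finite V"
  using orthonormal_independent[OF assms] finiteI_independent by blast

lemma orthonormal_expand:
  assumes V: "orthonormal V" and x: "x \<in> span V"
  shows "x = (\<Sum>v\<in>V. (x \<bullet> v) *\<^sub>R v)"
proof -
  obtain c where c: "x = (\<Sum>v\<in>V. c v *\<^sub>R v)"
    using x span_finite[OF orthonormal_finite[OF V]] by auto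
  have "x \<bullet> w = c w" if "w \<in> V" for w
  proof -
    have "x \<bullet> w = (\<Sum>v\<in>V. c v * (v \<bullet> w))" unfolding c by (simp add: inner_sum_left)
    also have "\<dots> = (\<Sum>v\<in>V. if v = w then c v else 0)"
      using that by (intro sum.cong) (auto simp: orthonormal_inner[OF V])
    also have "\<dots> = c w" using that orthonormal_finite[OF V] by simp
    finally show ?thesis .
  qed
  then show ?thesis using c by simp
qed

text \<open>A maximizer of the Rayleigh quotient on the unit sphere of \<open>S\<close> is an
  eigenvector: the first variation vanishes in all directions of \<open>S\<close> orthogonal to
  \<open>x\<close>, and \<open>f x - l x\<close> is such a direction.\<close>

lemma maximal_rayleigh_eigenvector:
  fixes f :: "'a::euclidean_space \<Rightarrow> 'a"
  assumes f: "linear f" and S: "subspace S" and inv: "\<And>x. x \<in> S \<Longrightarrow> f x \<in> S"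
    and sym: "\<And>x y. x \<in> S \<Longrightarrow> y \<in> S \<Longrightarrow> x \<bullet> f y = f x \<bullet> y"
    and ne: "S \<noteq> {0}"
  obtains x where "x \<in> S" "norm x = 1" "f x = (x \<bullet> f x) *\<^sub>R x"
proof -
  let ?K = "S \<inter> sphere 0 1"
  obtain z where z: "z \<in> S" "z \<noteq> 0" using ne subspace_0[OF S] by auto
  have "z /\<^sub>R norm z \<in> ?K" using z S by (simp add: subspace_scale)
  then have "?K \<noteq> {}" by blast
  moreover have "compact ?K" using closed_subspace[OF S] by (simp add: closed_Int_compact)
  moreover have "continuous_on ?K (\<lambda>x. x \<bullet> f x)"
    using f by (intro continuous_intros linear_continuous_on) (simp add: linear_conv_bounded_linear)
  ultimately obtain x where x: "x \<in> ?K" and max: "\<And>y. y \<in> ?K \<Longrightarrow> y \<bullet> f y \<le> x \<bullet> f x"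
    using continuous_attains_sup[of ?K "\<lambda>x. x \<bullet> f x"] by blast
  define l where "l = x \<bullet> f x"
  have xS: "x \<in> S" and nx: "x \<bullet> x = 1" using x by (auto simp: norm_eq_1)
  have le: "w \<bullet> f w \<le> l * (w \<bullet> w)" if "w \<in> S" for w
  proof (cases "w = 0")
    case True
    then show ?thesis by (simp add: linear_0[OF f])
  next
    case False
    have "w /\<^sub>R norm w \<in> ?K" using that False S by (simp add: subspace_scale)
    from max[OF this] have "(w \<bullet> f w) / (norm w)^2 \<le> l"
      by (simp add: linear_cmul[OF f] l_def power2_eq_square field_simps)
    then show ?thesis using False by (simp add: divide_simps power2_norm_eq_inner split: if_splits)
  qed
  have orth: "y \<bullet> f x = 0" if y: "y \<in> S" and xy: "x \<bullet> y = 0" for y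
  proof -
    define a b where "a = y \<bullet> f x" and "b = y \<bullet> f y - l * (y \<bullet> y)"
    have ab: "2 * t * a + t^2 * b \<le> 0" for t
    proof -
      have "x + t *\<^sub>R y \<in> S" using xS y S by (simp add: subspace_add subspace_scale)
      from le[OF this] have "l + 2 * t * a + t^2 * (y \<bullet> f y) \<le> l * (1 + t^2 * (y \<bullet> y))"
        using sym[OF xS y] xy nx
        by (simp add: linear_add[OF f] linear_cmul[OF f] inner_add_left inner_add_right a_def
            l_def[symmetric] inner_commute power2_eq_square algebra_simps)
      then show ?thesis by (simp add: b_def algebra_simps)
    qed
    have "a = 0"
    proof (rule ccontr)
      assume "a \<noteq> 0"
      \<comment> \<open>The linear term has to beat the quadratic one: since \<open>k\<close>
        exceeds \<open>\<bar>b\<bar>\<close>, the expression in \<open>ab\<close> is at least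
        \<open>a^2 / k\<close> at \<open>t = a / k\<close>.\<close>
      define k t where "k = \<bar>b\<bar> + 1" and "t = a / k"
      have k: "k > 0" "- k \<le> b" by (auto simp: k_def)
      have "0 < a^2 / k" using \<open>a \<noteq> 0\<close> k by simp
      also have "a^2 / k = 2 * t * a + t^2 * (- k)"
        using k by (simp add: t_def power2_eq_square divide_simps)
      also have "\<dots> \<le> 2 * t * a + t^2 * b" using mult_left_mono[OF k(2), of "t^2"] by simp
      finally show False using ab[of t] by simp
    qed
    then show ?thesis by (simp add: a_def)
  qed
  define y where "y = f x - l *\<^sub>R x"
  have "y \<in> S" using xS inv S by (simp add: y_def subspace_diff subspace_scale)
  moreover have xy: "x \<bullet> y = 0" by (simp add: y_def inner_diff_right nx l_def)
  ultimately have "y \<bullet> f x = 0" by (rule orth)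
  then have "y \<bullet> y = 0" using xy by (simp add: y_def inner_diff_right inner_commute)
  then have "f x = (x \<bullet> f x) *\<^sub>R x" by (simp add: y_def l_def)
  with that[of x] x show ?thesis by auto
qed

text \<open>Spectral theorem by induction on the dimension: symmetry makes the complement of an
  eigenvector in \<open>S\<close> invariant again. The version for subspaces serves the shape
  operator, whose symmetry is used on the tangent space only.\<close>

lemma selfadjoint_eigenbasis:
  fixes f :: "'a::euclidean_space \<Rightarrow> 'a"
  assumes f: "linear f" and S: "subspace S" and inv: "\<And>x. x \<in> S \<Longrightarrow> f x \<in> S"
    and sym: "\<And>x y. x \<in> S \<Longrightarrow> y \<in> S \<Longrightarrow> x \<bullet> f y = f x \<bullet> y"
  obtains V where "orthonormal V" "span V = S" "\<And>v. v \<in> V \<Longrightarrow> f v = (v \<bullet> f v) *\<^sub>R v"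
proof -
  have "\<exists>V. orthonormal V \<and> span V = S \<and> (\<forall>v\<in>V. f v = (v \<bullet> f v) *\<^sub>R v)"
    using S inv sym
  proof (induction "dim S" arbitrary: S rule: less_induct)
    case less
    show ?case
    proof (cases "S = {0}")
      case True
      then show ?thesis by (intro exI[of _ "{}"]) (simp add: orthonormal_def)
    next
      case False
      then obtain x where x: "x \<in> S" "norm x = 1" and fx: "f x = (x \<bullet> f x) *\<^sub>R x"
        using maximal_rayleigh_eigenvector[OF f less.prems] by metis
      have xx: "x \<bullet> x = 1" using x by (simp add: norm_eq_1)
      define T where "T = {y \<in> S. x \<bullet> y = 0}"
      have T: "subspace T" "T \<subseteq> S"
        using less.prems(1) by (auto simp: T_def subspace_def inner_add_right)
      have "x \<notin> T" using xx by (simp add: T_def)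
      then have "T \<subset> S" using T x by blast
      then have "dim T < dim S"
        using T(1) less.prems(1) by (simp add: dim_psubset span_eq_iff[THEN iffD2])
      moreover have "f y \<in> T" if "y \<in> T" for y
      proof -
        have "x \<bullet> f y = f x \<bullet> y" using that x less.prems(3) T by blast
        also have "\<dots> = 0" using that by (subst fx) (simp add: T_def)
        finally show ?thesis using that less.prems(2) by (simp add: T_def)
      qed
      moreover have "x \<bullet> f y = f x \<bullet> y" if "x \<in> T" "y \<in> T" for x y
        using that T less.prems(3) by blast
      ultimately obtain V where V: "orthonormal V" "span V = T" "\<forall>v\<in>V. f v = (v \<bullet> f v) *\<^sub>R v"
        using less.hyps[OF _ T(1)] by metis
      have VT: "V \<subseteq> T" using V(2) span_superset by blast
      have "orthonormal (insert x V)"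
        using V(1) x VT unfolding orthonormal_def
        by (auto simp: pairwise_insert orthogonal_def T_def inner_commute)
      moreover have "span (insert x V) = S"
      proof
        show "span (insert x V) \<subseteq> S"
          using VT T x less.prems(1) by (intro span_minimal) auto
        show "S \<subseteq> span (insert x V)"
        proof
          fix y assume y: "y \<in> S"
          have "y - (x \<bullet> y) *\<^sub>R x \<in> T"
            using y x less.prems(1) xx by (simp add: T_def subspace_diff subspace_scale inner_diff_right)
          then have "y - (x \<bullet> y) *\<^sub>R x \<in> span (insert x V)"
            using V(2) span_mono[of V "insert x V"] by blast
          moreover have "(x \<bullet> y) *\<^sub>R x \<in> span (insert x V)"
            by (simp add: span_base span_scale)
          ultimately show "y \<in> span (insert x V)"
            using span_add by fastforce
        qed
      qed
      ultimately show ?thesis using V(3) fx by blast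
    qed
  qed
  then show ?thesis using that by blast
qed

section \<open>Traces of operators\<close>

definition optrace :: "('a::euclidean_space \<Rightarrow> 'a) \<Rightarrow> real"
  where "optrace f = (\<Sum>b\<in>Basis. b \<bullet> f b)"

text \<open>Both sides equal the double sum of \<open>(v \<bullet> b) * (v \<bullet> f b)\<close>
  over \<open>V\<close> and \<open>Basis\<close>: expand \<open>v\<close> in \<open>Basis\<close>,
  and \<open>b\<close> in \<open>V\<close>.\<close>

lemma optrace_orthonormal:
  fixes f :: "'a::euclidean_space \<Rightarrow> 'a"
  assumes V: "orthonormal V" "span V = UNIV" and f: "linear f"
  shows "optrace f = (\<Sum>v\<in>V. v \<bullet> f v)"
proof -
  have "v \<bullet> f v = (\<Sum>b\<in>Basis. (v \<bullet> b) * (v \<bullet> f b))" for v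
  proof -
    have "f v = f (\<Sum>b\<in>Basis. (v \<bullet> b) *\<^sub>R b)" by (simp add: euclidean_representation)
    also have "\<dots> = (\<Sum>b\<in>Basis. (v \<bullet> b) *\<^sub>R f b)"
      by (simp add: linear_sum[OF f] linear_cmul[OF f])
    finally show ?thesis by (simp add: inner_sum_right)
  qed
  then have "(\<Sum>v\<in>V. v \<bullet> f v) = (\<Sum>b\<in>Basis. \<Sum>v\<in>V. (v \<bullet> b) * (v \<bullet> f b))"
    by (simp add: sum.swap[of _ V])
  also have "\<dots> = (\<Sum>b\<in>Basis. b \<bullet> f b)"
  proof (rule sum.cong[OF refl])
    fix b :: 'a
    have "b \<bullet> f b = (\<Sum>v\<in>V. (v \<bullet> b) * (v \<bullet> f b))"
      using arg_cong[OF orthonormal_expand[OF V(1), of b], of "\<lambda>x. x \<bullet> f b"] V(2)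
      by (simp add: inner_sum_left inner_commute[of b])
    then show "(\<Sum>v\<in>V. (v \<bullet> b) * (v \<bullet> f b)) = b \<bullet> f b"
      by simp
  qed
  finally show ?thesis by (simp add: optrace_def)
qed

text \<open>In an eigenbasis of \<open>M\<close> the trace is a sum of products of an eigenvalue of
  \<open>M\<close> with a diagonal entry of \<open>H\<close>. Both the barrier argument and the
  maximum principle rest on this.\<close>

lemma optrace_psd_nsd_le:
  fixes M H :: "'a::euclidean_space \<Rightarrow> 'a"
  assumes M: "linear M" and H: "linear H" and sym: "\<And>x y. x \<bullet> M y = M x \<bullet> y"
    and psd: "\<And>y. y \<bullet> M y \<ge> 0" and nsd: "\<And>y. y \<bullet> H y \<le> 0"
  shows "optrace (\<lambda>x. M (H x)) \<le> 0"
proof -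
  obtain V where V: "orthonormal V" "span V = UNIV" and eig: "\<And>v. v \<in> V \<Longrightarrow> M v = (v \<bullet> M v) *\<^sub>R v"
    using selfadjoint_eigenbasis[OF M subspace_UNIV] sym by auto
  have "optrace (\<lambda>x. M (H x)) = (\<Sum>v\<in>V. v \<bullet> M (H v))"
    using V linear_compose[OF H M] by (simp add: optrace_orthonormal o_def)
  also have "\<dots> = (\<Sum>v\<in>V. (v \<bullet> M v) * (v \<bullet> H v))"
  proof (rule sum.cong[OF refl])
    fix v assume "v \<in> V"
    have "v \<bullet> M (H v) = M v \<bullet> H v" by (rule sym)
    also have "\<dots> = (v \<bullet> M v) * (v \<bullet> H v)" by (subst eig[OF \<open>v \<in> V\<close>]) simp
    finally show "v \<bullet> M (H v) = (v \<bullet> M v) * (v \<bullet> H v)" .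
  qed
  also have "\<dots> \<le> 0" using psd nsd by (intro sum_nonpos) (simp add: mult_nonneg_nonpos)
  finally show ?thesis .
qed

lemma optrace_add: "optrace (\<lambda>x. f x + g x) = optrace f + optrace g"
  by (simp add: optrace_def inner_add_right sum.distrib)

lemma optrace_diff: "optrace (\<lambda>x. f x - g x) = optrace f - optrace g"
  by (simp add: optrace_def inner_diff_right sum_subtractf)

lemma optrace_scaleR: "optrace (\<lambda>x. c *\<^sub>R f x) = c * optrace f"
  by (simp add: optrace_def sum_distrib_left)

lemma optrace_rank_one:
  fixes w z :: "'a::euclidean_space"
  assumes "linear h"
  shows "optrace (\<lambda>x. (w \<bullet> h x) *\<^sub>R z) = w \<bullet> h z"
proof -
  have "h z = h (\<Sum>b\<in>Basis. (z \<bullet> b) *\<^sub>R b)" by (simp add: euclidean_representation)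
  also have "\<dots> = (\<Sum>b\<in>Basis. (z \<bullet> b) *\<^sub>R h b)"
    by (simp add: linear_sum[OF assms] linear_cmul[OF assms])
  finally show ?thesis
    by (simp add: optrace_def inner_sum_right inner_commute mult.commute)
qed

lemma optrace_id: "optrace (\<lambda>x::'a::euclidean_space. x) = DIM('a)"
  by (simp add: optrace_def)

section \<open>Second-order jets and the barrier principle\<close>

text \<open>Gradient and Hessian are explicit data, which keeps the comparison arguments free of
  coordinates; the Hessian is the derivative of the gradient and may be discontinuous.\<close>

definition jet2_on :: "'a::euclidean_space set \<Rightarrow> ('a \<Rightarrow> real) \<Rightarrow> ('a \<Rightarrow> 'a) \<Rightarrow> ('a \<Rightarrow> 'a \<Rightarrow> 'a) \<Rightarrow> bool"
  where "jet2_on S f g H \<longleftrightarrow>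
    (\<forall>x\<in>S. (f has_derivative (\<lambda>y. g x \<bullet> y)) (at x) \<and> (g has_derivative H x) (at x))"

lemma jet2_onD:
  assumes "jet2_on S f g H" "x \<in> S"
  shows "(f has_derivative (\<lambda>y. g x \<bullet> y)) (at x)" "(g has_derivative H x) (at x)"
  using assms by (auto simp: jet2_on_def)

lemma jet2_on_subset: "jet2_on S f g H \<Longrightarrow> T \<subseteq> S \<Longrightarrow> jet2_on T f g H"
  by (auto simp: jet2_on_def)

lemma has_real_derivative_along_line:
  fixes f :: "'a::euclidean_space \<Rightarrow> real"
  assumes "(f has_derivative (\<lambda>y. d \<bullet> y)) (at (x + t *\<^sub>R v))"
  shows "((\<lambda>t. f (x + t *\<^sub>R v)) has_real_derivative d \<bullet> v) (at t)"
proof -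
  have "((\<lambda>t. x + t *\<^sub>R v) has_derivative (\<lambda>t. t *\<^sub>R v)) (at t)"
    by (auto intro!: derivative_eq_intros)
  from has_derivative_compose[OF this assms]
  show ?thesis by (simp add: has_field_derivative_def mult.commute mult_commute_abs)
qed

text \<open>On the line through \<open>x0\<close> in direction \<open>y\<close>, a positive second
  derivative at a critical point makes the first derivative positive just to the right of 0, so
  \<open>f\<close> would exceed its maximum.\<close>

lemma second_order_max:
  fixes f :: "'a::euclidean_space \<Rightarrow> real"
  assumes S: "open S" "x0 \<in> S"
    and f: "\<And>x. x \<in> S \<Longrightarrow> (f has_derivative (\<lambda>y. g x \<bullet> y)) (at x)"
    and g: "(g has_derivative H) (at x0)"
    and max: "\<And>x. x \<in> S \<Longrightarrow> f x \<le> f x0"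
  shows "g x0 = 0" "y \<bullet> H y \<le> 0"
proof -
  have *: "g x0 \<bullet> y = 0 \<and> y \<bullet> H y \<le> 0" for y
  proof -
    obtain e where e: "e > 0" "ball x0 e \<subseteq> S" using S open_contains_ball by blast
    define d where "d = e / (norm y + 1)"
    have d: "d > 0" using e by (simp add: d_def add_nonneg_pos)
    have inS: "x0 + t *\<^sub>R y \<in> S" if "\<bar>t\<bar> < d" for t
    proof -
      have "\<bar>t\<bar> * norm y \<le> \<bar>t\<bar> * (norm y + 1)" by (simp add: mult_left_mono)
      also have "\<dots> < e"
        using that by (simp add: d_def pos_less_divide_eq add_nonneg_pos)
      finally show ?thesis using e by (auto simp: dist_norm)
    qed
    let ?\<phi> = "\<lambda>t. f (x0 + t *\<^sub>R y)"
    let ?\<psi> = "\<lambda>t. g (x0 + t *\<^sub>R y) \<bullet> y"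
    have \<phi>: "(?\<phi> has_real_derivative ?\<psi> t) (at t)" if "\<bar>t\<bar> < d" for t
      by (intro has_real_derivative_along_line f inS that)
    have "?\<psi> 0 = 0"
      using DERIV_local_max[OF \<phi>[of 0] d] d max inS by simp
    moreover have "y \<bullet> H y \<le> 0"
    proof (rule ccontr)
      assume neg: "\<not> y \<bullet> H y \<le> 0"
      have "((\<lambda>x. g x \<bullet> y) has_derivative (\<lambda>z. H z \<bullet> y)) (at x0)"
        by (intro has_derivative_inner_left g)
      moreover have "((\<lambda>t. x0 + t *\<^sub>R y) has_derivative (\<lambda>t. t *\<^sub>R y)) (at 0)"
        by (auto intro!: derivative_eq_intros)
      ultimately have "(?\<psi> has_derivative (\<lambda>t. H (t *\<^sub>R y) \<bullet> y)) (at 0)"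
        using has_derivative_compose[of "\<lambda>t. x0 + t *\<^sub>R y" "\<lambda>t. t *\<^sub>R y" 0 UNIV "\<lambda>x. g x \<bullet> y"] by simp
      then have "(?\<psi> has_real_derivative (y \<bullet> H y)) (at 0)"
        using linear_cmul[OF has_derivative_linear[OF g]]
        by (simp add: has_field_derivative_def inner_commute mult_commute_abs)
      from DERIV_pos_inc_right[OF this] neg \<open>?\<psi> 0 = 0\<close>
      obtain c where c: "c > 0" "\<And>h. 0 < h \<Longrightarrow> h < c \<Longrightarrow> 0 < ?\<psi> h" by auto
      define b where "b = min c d / 2"
      have b: "0 < b" "b < c" "b < d" using c d by (auto simp: b_def)
      have "?\<phi> 0 < ?\<phi> b"
      proof (rule DERIV_pos_imp_increasing_open[OF b(1)])
        show "\<exists>y'. (?\<phi> has_real_derivative y') (at t) \<and> y' > 0" if "0 < t" "t < b" for t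
          using \<phi>[of t] c(2)[of t] that b by auto
        show "continuous_on {0..b} ?\<phi>"
          using b by (intro continuous_at_imp_continuous_on ballI DERIV_isCont[OF \<phi>]) auto
      qed
      then show False using max[OF inS[of b]] b by simp
    qed
    ultimately show ?thesis by simp
  qed
  have "g x0 \<bullet> g x0 = 0" using * by blast
  then show "g x0 = 0" by simp
  show "y \<bullet> H y \<le> 0" using * by blast
qed

text \<open>The second difference \<open>\<Delta>\<close> is symmetric in \<open>a\<close> and
  \<open>b\<close>, and by the mean value theorem it equals \<open>t^2 * (a \<bullet> H b)\<close>
  up to \<open>o(t^2)\<close>. Differentiability of the gradient at the single point
  \<open>x\<close> suffices for that.\<close>

lemma hessian_symmetric:
  fixes f :: "'a::euclidean_space \<Rightarrow> real"
  assumes S: "open S" "x \<in> S"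
    and f: "\<And>x. x \<in> S \<Longrightarrow> (f has_derivative (\<lambda>y. g x \<bullet> y)) (at x)"
    and g: "(g has_derivative H) (at x)"
  shows "a \<bullet> H b = H a \<bullet> b"
proof -
  have H: "linear H" using g has_derivative_linear by blast
  define \<Delta> where "\<Delta> a b t = f (x + t *\<^sub>R a + t *\<^sub>R b) - f (x + t *\<^sub>R a) - f (x + t *\<^sub>R b) + f x" for a b t
  have main: "\<exists>d>0. \<forall>t. 0 < t \<and> t < d \<longrightarrow> \<bar>\<Delta> a b t - t^2 * (a \<bullet> H b)\<bar> \<le> e * t^2"
    if e: "e > 0" for e a b
  proof -
    obtain r where r: "r > 0" "ball x r \<subseteq> S" using S open_contains_ball by blast
    define k where "k = norm a + norm b + 1"
    have k: "k \<ge> 1" "norm a \<le> k" "norm b \<le> k" "norm a + norm b \<le> k" by (auto simp: k_def)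
    \<comment> \<open>Chosen so that the final error \<open>t * ((2 * (e' * (t * k))) * k)\<close>
      is exactly \<open>e * t^2\<close>.\<close>
    define e' where "e' = e / (2 * k * k)"
    have e': "e' > 0" using e k by (simp add: e'_def)
    obtain c where c: "c > 0" "\<And>y. norm (y - x) < c \<Longrightarrow> norm (g y - g x - H (y - x)) \<le> e' * norm (y - x)"
      using g e' unfolding has_derivative_at_alt by blast
    define d where "d = min r c / k"
    have d: "d > 0" using r c k by (simp add: d_def)
    have "\<bar>\<Delta> a b t - t^2 * (a \<bullet> H b)\<bar> \<le> e * t^2" if t: "0 < t" "t < d" for t
    proof -
      have small: "norm (s *\<^sub>R a + s' *\<^sub>R b) \<le> t * k \<and> norm (s *\<^sub>R a + s' *\<^sub>R b) < r \<and> norm (s *\<^sub>R a + s' *\<^sub>R b) < c"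
        if "0 \<le> s" "s \<le> t" "0 \<le> s'" "s' \<le> t" for s s'
      proof -
        have "norm (s *\<^sub>R a + s' *\<^sub>R b) \<le> s * norm a + s' * norm b"
          using that by (intro norm_triangle_le) simp
        also have "\<dots> \<le> t * norm a + t * norm b"
          using that by (intro add_mono mult_right_mono) auto
        also have "\<dots> \<le> t * k" using k t by (simp add: distrib_left[symmetric])
        finally have "norm (s *\<^sub>R a + s' *\<^sub>R b) \<le> t * k" .
        moreover have "t * k < min r c" using t k by (simp add: d_def pos_less_divide_eq)
        ultimately show ?thesis by simp
      qed
      have inS: "x + s *\<^sub>R a + s' *\<^sub>R b \<in> S" if "0 \<le> s" "s \<le> t" "0 \<le> s'" "s' \<le> t" for s s'
      proof -
        have "dist x (x + s *\<^sub>R a + s' *\<^sub>R b) = norm (s *\<^sub>R a + s' *\<^sub>R b)"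
          using norm_minus_cancel[of "s *\<^sub>R a + s' *\<^sub>R b"] by (simp add: dist_norm)
        then have "x + s *\<^sub>R a + s' *\<^sub>R b \<in> ball x r" using small[OF that] by simp
        then show ?thesis using r by blast
      qed
      let ?k = "\<lambda>s. f (x + t *\<^sub>R b + s *\<^sub>R a) - f (x + s *\<^sub>R a)"
      have "(?k has_real_derivative (g (x + t *\<^sub>R b + s *\<^sub>R a) \<bullet> a - g (x + s *\<^sub>R a) \<bullet> a)) (at s)"
        if "0 \<le> s" "s \<le> t" for s
      proof -
        have "x + t *\<^sub>R b + s *\<^sub>R a \<in> S" "x + s *\<^sub>R a \<in> S"
          using inS[of s t] inS[of s 0] that t by (simp_all add: ac_simps)
        then show ?thesis by (intro DERIV_diff has_real_derivative_along_line f)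
      qed
      from MVT2[OF t(1) this] obtain s where s: "0 < s" "s < t"
        and eq: "?k t - ?k 0 = t * (g (x + t *\<^sub>R b + s *\<^sub>R a) \<bullet> a - g (x + s *\<^sub>R a) \<bullet> a)"
        by auto
      define A where "A = g (x + t *\<^sub>R b + s *\<^sub>R a) - g x - H (s *\<^sub>R a + t *\<^sub>R b)"
      define B where "B = g (x + s *\<^sub>R a) - g x - H (s *\<^sub>R a)"
      have "norm A \<le> e' * norm (s *\<^sub>R a + t *\<^sub>R b)"
        using c(2)[of "x + t *\<^sub>R b + s *\<^sub>R a"] small[of s t] s t by (simp add: A_def add.commute)
      also have "\<dots> \<le> e' * (t * k)" using small[of s t] s t e' by (intro mult_left_mono) auto
      finally have A: "norm A \<le> e' * (t * k)" .
      have "norm B \<le> e' * norm (s *\<^sub>R a)"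
        using c(2)[of "x + s *\<^sub>R a"] small[of s 0] s t by (simp add: B_def)
      also have "\<dots> \<le> e' * (t * k)" using small[of s 0] s t e' by (intro mult_left_mono) auto
      finally have B: "norm B \<le> e' * (t * k)" .
      have "\<Delta> a b t = ?k t - ?k 0" by (simp add: \<Delta>_def algebra_simps)
      also have "\<dots> = t * ((t *\<^sub>R H b + A - B) \<bullet> a)"
        unfolding eq by (simp add: A_def B_def linear_add[OF H] linear_cmul[OF H] inner_diff_left inner_add_left)
      finally have "\<Delta> a b t - t^2 * (a \<bullet> H b) = t * ((A - B) \<bullet> a)"
        by (simp add: inner_diff_left inner_add_left inner_commute power2_eq_square algebra_simps)
      then have "\<bar>\<Delta> a b t - t^2 * (a \<bullet> H b)\<bar> = t * \<bar>(A - B) \<bullet> a\<bar>" using t by (simp add: abs_mult)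
      also have "\<dots> \<le> t * (norm (A - B) * norm a)" using t Cauchy_Schwarz_ineq2 by simp
      also have "\<dots> \<le> t * ((2 * (e' * (t * k))) * k)"
        using t A B k e' norm_triangle_ineq4[of A B] by (intro mult_left_mono mult_mono) auto
      also have "\<dots> = e * t^2" using k by (simp add: e'_def power2_eq_square)
      finally show ?thesis .
    qed
    then show ?thesis using d by blast
  qed
  have "\<bar>a \<bullet> H b - b \<bullet> H a\<bar> \<le> 2 * e" if e: "e > 0" for e
  proof -
    obtain d where d: "d > 0" "\<And>t. 0 < t \<Longrightarrow> t < d \<Longrightarrow> \<bar>\<Delta> a b t - t^2 * (a \<bullet> H b)\<bar> \<le> e * t^2"
      using main[OF e] by blast
    obtain d' where d': "d' > 0" "\<And>t. 0 < t \<Longrightarrow> t < d' \<Longrightarrow> \<bar>\<Delta> b a t - t^2 * (b \<bullet> H a)\<bar> \<le> e * t^2"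
      using main[OF e] by blast
    define t where "t = min d d' / 2"
    have t: "0 < t" "t < d" "t < d'" using d d' by (auto simp: t_def)
    have "\<Delta> a b t = \<Delta> b a t" by (simp add: \<Delta>_def algebra_simps)
    then have "t^2 * \<bar>a \<bullet> H b - b \<bullet> H a\<bar> \<le> t^2 * (2 * e)"
      using d(2)[OF t(1,2)] d'(2)[OF t(1,3)] abs_mult[of "t^2" "a \<bullet> H b - b \<bullet> H a"]
      by (simp add: algebra_simps)
    then show ?thesis using t by simp
  qed
  \<comment> \<open>At a quarter of the discrepancy the bound says that the discrepancy is at most
    half of itself.\<close>
  from this[of "\<bar>a \<bullet> H b - b \<bullet> H a\<bar> / 4"] have "a \<bullet> H b = b \<bullet> H a" by (cases "a \<bullet> H b = b \<bullet> H a") auto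
  then show ?thesis by (simp add: inner_commute)
qed

text \<open>Any slope below the directional derivative is beaten on a short ray. Such strict bounds
  combine as eventual properties, so that one small \<open>t\<close> serves several
  functions.\<close>

lemma eventually_above_line:
  fixes f :: "'a::euclidean_space \<Rightarrow> real"
  assumes "(f has_derivative (\<lambda>y. d \<bullet> y)) (at x)" and "a < d \<bullet> v"
  shows "\<forall>\<^sub>F t in at_right 0. f x + t * a < f (x + t *\<^sub>R v)"
proof -
  have "((\<lambda>t. f (x + t *\<^sub>R v) - t * a) has_real_derivative (d \<bullet> v - a)) (at 0)"
    using has_real_derivative_along_line[of f d x 0 v] assms(1)
    by (auto intro!: derivative_eq_intros)
  from DERIV_pos_inc_right[OF this] assms(2)
  obtain c where "c > 0" "\<And>h. 0 < h \<Longrightarrow> h < c \<Longrightarrow> f x < f (x + h *\<^sub>R v) - h * a" by auto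
  then show ?thesis
    unfolding eventually_at_right_field by (intro exI[of _ c]) (auto simp: algebra_simps)
qed

text \<open>With \<open>B = A\<^sup>-\<^sup>1\<close>, this is \<open>1 + p \<bullet> B p\<close> times the trace of \<open>(A + p p\<^sup>T)\<^sup>-\<^sup>1 H\<close>
  (Sherman--Morrison).\<close>

definition minop :: "('a::euclidean_space \<Rightarrow> 'a) \<Rightarrow> 'a \<Rightarrow> ('a \<Rightarrow> 'a) \<Rightarrow> real"
  where "minop B p H = (1 + p \<bullet> B p) * optrace (\<lambda>x. B (H x)) - B p \<bullet> H (B p)"

text \<open>\<open>minop B p H\<close> is the trace of \<open>M H\<close> with
  \<open>M = (1 + d) B - (B p)(B p)^T\<close>, and \<open>M\<close> is positive semidefinite by the
  Cauchy-Schwarz inequality for the form of \<open>B\<close>.\<close>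

lemma minop_nsd_le:
  fixes B H :: "'a::euclidean_space \<Rightarrow> 'a"
  assumes B: "linear B" and H: "linear H" and sym: "\<And>x y. x \<bullet> B y = B x \<bullet> y"
    and psd: "\<And>y. y \<bullet> B y \<ge> 0" and nsd: "\<And>y. y \<bullet> H y \<le> 0"
  shows "minop B p H \<le> 0"
proof -
  define d where "d = p \<bullet> B p"
  have d: "d \<ge> 0" using psd by (simp add: d_def)
  define M where "M y = (1 + d) *\<^sub>R B y - (B p \<bullet> y) *\<^sub>R B p" for y
  have "linear M"
    by (rule linearI) (simp_all add: M_def linear_add[OF B] linear_cmul[OF B] algebra_simps inner_add_right)
  moreover have "x \<bullet> M y = M x \<bullet> y" for x y
    by (simp add: M_def inner_diff_right inner_diff_left sym[of x y] inner_commute[of x "B p"])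
  moreover have "y \<bullet> M y \<ge> 0" for y
  proof -
    define a b where "a = y \<bullet> B y" and "b = B p \<bullet> y"
    have yp: "y \<bullet> B p = b" "p \<bullet> B y = b" by (simp_all add: b_def sym[of p y] inner_commute)
    define e where "e = 1 + d"
    \<comment> \<open>This test vector gives the Cauchy-Schwarz bound without a division by
      \<open>d\<close>, which may vanish.\<close>
    have "0 \<le> (e *\<^sub>R y - b *\<^sub>R p) \<bullet> B (e *\<^sub>R y - b *\<^sub>R p)" by (rule psd)
    also have "\<dots> = e^2 * a - 2 * e * b^2 + b^2 * d"
      by (simp add: linear_diff[OF B] linear_cmul[OF B] inner_diff_left inner_diff_right yp
          a_def[symmetric] d_def[symmetric] power2_eq_square algebra_simps)
    also have "\<dots> \<le> e * (e * a - b^2)"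
      by (simp add: e_def power2_eq_square algebra_simps)
    finally have "(1 + d) * a - b^2 \<ge> 0" using d by (simp add: zero_le_mult_iff e_def)
    moreover have "y \<bullet> M y = (1 + d) * a - b^2"
      by (simp add: M_def inner_diff_right a_def[symmetric] b_def[symmetric] yp power2_eq_square)
    ultimately show ?thesis by simp
  qed
  ultimately have "optrace (\<lambda>x. M (H x)) \<le> 0" using H nsd by (intro optrace_psd_nsd_le)
  moreover have "optrace (\<lambda>x. M (H x)) = minop B p H"
    using optrace_rank_one[OF H]
    by (simp add: M_def minop_def optrace_diff optrace_scaleR d_def)
  ultimately show ?thesis by simp
qed

text \<open>For \<open>v = h \<circ> s\<close> the operator \<open>minop B\<close> takes the value
  \<open>h'' (Ds \<bullet> B Ds) + h' tr (B D\<^sup>2s) + h'\<^sup>3 E\<close>, where \<open>E\<close> is the following quantity; it is a positive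
  multiple of minus the mean curvature of the level sets of \<open>s\<close> in the metric \<open>B\<^sup>-\<^sup>1\<close>.\<close>

definition barrier_curvature :: "('a::euclidean_space \<Rightarrow> 'a) \<Rightarrow> 'a \<Rightarrow> ('a \<Rightarrow> 'a) \<Rightarrow> real"
  where "barrier_curvature B p H = (p \<bullet> B p) * optrace (\<lambda>x. B (H x)) - B p \<bullet> H (B p)"

text \<open>Comparison with the strict supersolution \<open>m + C (sqrt R - sqrt (s - \<delta>))\<close>. Its slope is infinite on
  \<open>{s = \<delta>}\<close>, so that \<open>u\<close> needs no bound on the part of the level set inside \<open>G\<close>.\<close>

lemma barrier_bound:
  fixes u s :: "'a::euclidean_space \<Rightarrow> real"
  assumes B: "linear B" and sym: "\<And>x y. x \<bullet> B y = B x \<bullet> y" and psd: "\<And>y. y \<bullet> B y \<ge> 0"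
    and K: "compact K" and G: "open G" and KG: "K \<inter> G = {x \<in> G. \<delta> \<le> s x}"
    and cu: "continuous_on K u" and cs: "continuous_on K s"
    and ju: "jet2_on G u gu Hu" and js: "jet2_on G s gs Hs"
    and eq: "\<And>x. x \<in> G \<Longrightarrow> minop B (gu x) (Hu x) = 0"
    and sK: "\<And>x. x \<in> K \<Longrightarrow> \<delta> \<le> s x \<and> s x \<le> \<delta> + R"
    and m: "\<And>x. x \<in> K \<Longrightarrow> x \<notin> G \<Longrightarrow> u x \<le> m"
    and E: "\<And>x. x \<in> K \<Longrightarrow> x \<in> G \<Longrightarrow> E0 \<le> barrier_curvature B (gs x) (Hs x)" "E0 > 0"
    and N: "\<And>x. x \<in> K \<Longrightarrow> x \<in> G \<Longrightarrow> gs x \<bullet> B (gs x) \<le> N0"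
    and T: "\<And>x. x \<in> K \<Longrightarrow> x \<in> G \<Longrightarrow> \<bar>optrace (\<lambda>y. B (Hs x y))\<bar> \<le> T0"
    and C: "C > 0" "C^2 * E0 > 2 * N0 + 4 * R * T0"
    and x: "x \<in> K"
  shows "u x \<le> m + C * sqrt R"
proof -
  \<comment> \<open>Up to a constant, \<open>f\<close> is \<open>u\<close> minus the barrier. Where
    its maximum lies outside \<open>G\<close>, the bound \<open>m\<close> is available; so a maximum
    in \<open>G\<close> is to be excluded.\<close>
  define f where "f x = u x + C * sqrt (s x - \<delta>)" for x
  have "continuous_on K f" unfolding f_def by (intro continuous_intros cu cs)
  then obtain x0 where x0: "x0 \<in> K" and max: "\<And>y. y \<in> K \<Longrightarrow> f y \<le> f x0"
    using continuous_attains_sup[OF K, of f] x by blast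
  have "x0 \<notin> G"
  proof
    assume xG: "x0 \<in> G"
    define N' T' E' where "N' = gs x0 \<bullet> B (gs x0)" and "T' = optrace (\<lambda>y. B (Hs x0 y))"
      and "E' = barrier_curvature B (gs x0) (Hs x0)"
    have E': "E' \<ge> E0" "E' > 0" using E x0 xG by (force simp: E'_def)+
    show False
    proof (cases "s x0 = \<delta>")
      case True
      define w where "w = gs x0"
      have "w \<noteq> 0"
      proof
        assume "w = 0"
        then have "E' = 0"
          using linear_0[OF B] linear_0[OF has_derivative_linear[OF jet2_onD(2)[OF js xG]]]
          by (simp add: E'_def w_def barrier_curvature_def)
        then show False using E' by simp
      qed
      \<comment> \<open>Along \<open>w\<close> the square root gains at least
        \<open>C * sqrt (t * n)\<close>, while \<open>u\<close> loses at most \<open>t * L\<close>.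
        The two balance at \<open>t = C^2 * n / L^2\<close>; below that the gain wins.\<close>
      define n where "n = (norm w)^2 / 2"
      have n: "n > 0" "n < w \<bullet> w" using \<open>w \<noteq> 0\<close> by (auto simp: n_def power2_norm_eq_inner)
      define L where "L = \<bar>gu x0 \<bullet> w\<bar> + 1"
      have L: "L > 0" "- L < gu x0 \<bullet> w" by (auto simp: L_def)
      have "((\<lambda>t. x0 + t *\<^sub>R w) \<longlongrightarrow> x0) (at_right 0)"
        by (auto intro!: tendsto_eq_intros)
      then have "\<forall>\<^sub>F t in at_right 0. x0 + t *\<^sub>R w \<in> G" using G xG by (rule topological_tendstoD)
      moreover have "\<forall>\<^sub>F t in at_right 0. s x0 + t * n < s (x0 + t *\<^sub>R w)"
        by (rule eventually_above_line[OF jet2_onD(1)[OF js xG]]) (use n in \<open>simp add: w_def\<close>)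
      moreover have "\<forall>\<^sub>F t in at_right 0. u x0 + t * (- L) < u (x0 + t *\<^sub>R w)"
        by (rule eventually_above_line[OF jet2_onD(1)[OF ju xG]]) (use L in simp)
      moreover have "\<forall>\<^sub>F t in at_right 0. t < C^2 * n / L^2"
        using C n L by (intro eventually_at_right_less order_tendstoD(2)[of _ 0]) (auto intro!: tendsto_eq_intros)
      moreover have "\<forall>\<^sub>F t in at_right 0. (0::real) < t" by (rule eventually_at_right_less)
      ultimately have "\<forall>\<^sub>F t in at_right 0. x0 + t *\<^sub>R w \<in> G \<and> s x0 + t * n < s (x0 + t *\<^sub>R w) \<and>
          u x0 + t * (- L) < u (x0 + t *\<^sub>R w) \<and> t < C^2 * n / L^2 \<and> 0 < t"
        by eventually_elim blast
      then obtain t where elim: "x0 + t *\<^sub>R w \<in> G" "s x0 + t * n < s (x0 + t *\<^sub>R w)"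
          "u x0 + t * (- L) < u (x0 + t *\<^sub>R w)" "t < C^2 * n / L^2" "0 < t"
        using eventually_happens'[OF trivial_limit_at_right_real] by blast
      show False
      proof -
        have "0 < t * n" using elim n by simp
        then have "x0 + t *\<^sub>R w \<in> {x \<in> G. \<delta> \<le> s x}" using elim True by simp
        then have "x0 + t *\<^sub>R w \<in> K" using KG by blast
        from max[OF this] have "u (x0 + t *\<^sub>R w) + C * sqrt (s (x0 + t *\<^sub>R w) - \<delta>) \<le> u x0"
          by (simp add: f_def True)
        moreover have "sqrt (t * n) \<le> sqrt (s (x0 + t *\<^sub>R w) - \<delta>)" using elim True by simp
        then have "C * sqrt (t * n) \<le> C * sqrt (s (x0 + t *\<^sub>R w) - \<delta>)"
          using C by (intro mult_left_mono) auto
        ultimately have "C * sqrt (t * n) \<le> t * L"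
          using elim by simp
        then have "(C * sqrt (t * n))^2 \<le> (t * L)^2"
          using C elim n by (intro power_mono) auto
        then have "C^2 * (t * n) \<le> t^2 * L^2" using elim n by (simp add: power_mult_distrib)
        then have "t * (C^2 * n) \<le> t * (t * L^2)" by (simp add: power2_eq_square algebra_simps)
        then have "C^2 * n \<le> t * L^2" using elim by simp
        then show False using elim L by (simp add: pos_less_divide_eq)
      qed
    next
      case False
      \<comment> \<open>Off the level set \<open>{s = \<delta>}\<close> the barrier is twice
        differentiable, and the second-order conditions at a maximum apply.\<close>
      define S where "S = {x \<in> G. \<delta> < s x}"
      have sG: "continuous_on G s"
        using jet2_onD(1)[OF js] by (intro continuous_at_imp_continuous_on ballI has_derivative_continuous)
      have S: "open S" using continuous_open_preimage[OF sG G, of "{\<delta><..}"]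
        by (simp add: S_def vimage_def Int_def)
      have x0S: "x0 \<in> S" using False sK[OF x0] xG by (auto simp: S_def)
      define k where "k x = C / (2 * sqrt (s x - \<delta>))" for x
      define w where "w = sqrt (s x0 - \<delta>)"
      have w: "w > 0" "w^2 = s x0 - \<delta>" using x0S by (auto simp: w_def S_def)
      define gf where "gf x = gu x + k x *\<^sub>R gs x" for x
      have f': "(f has_derivative (\<lambda>y. gf x \<bullet> y)) (at x)" if "x \<in> S" for x
        unfolding f_def gf_def k_def using that
        by (auto simp: S_def inner_add_left field_simps
            intro!: derivative_eq_intros jet2_onD(1)[OF ju] jet2_onD(1)[OF js])
      \<comment> \<open>The derivative of \<open>C / (2 * sqrt (s - \<delta>))\<close> with respect
        to \<open>s\<close>, at \<open>x0\<close>.\<close>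
      define k' where "k' = - C / (4 * w^3)"
      have k0: "k x0 = C / (2 * w)" by (simp add: k_def w_def)
      have kd: "(k has_derivative (\<lambda>y. k' * (gs x0 \<bullet> y))) (at x0)"
        unfolding k_def using x0S xG
        apply (auto simp: S_def k'_def w_def[symmetric]
            intro!: derivative_eq_intros jet2_onD(1)[OF js])
        using w by (auto simp: fun_eq_iff field_simps power3_eq_cube power2_eq_square)
      define Hf where "Hf y = Hu x0 y + (k x0 *\<^sub>R Hs x0 y + (k' * (gs x0 \<bullet> y)) *\<^sub>R gs x0)" for y
      have gf': "(gf has_derivative Hf) (at x0)"
        unfolding gf_def Hf_def
        by (intro has_derivative_add has_derivative_scaleR kd jet2_onD(2)[OF ju xG] jet2_onD(2)[OF js xG])
      have max': "f x \<le> f x0" if "x \<in> S" for x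
      proof -
        have "x \<in> K \<inter> G" using that unfolding KG S_def by simp
        then show ?thesis using max by blast
      qed
      have "gf x0 = 0" and nsd: "\<And>y. y \<bullet> Hf y \<le> 0"
        using second_order_max[OF S x0S f' gf' max'] by auto
      then have p: "gu x0 = - k x0 *\<^sub>R gs x0" by (simp add: gf_def add_eq_0_iff2)
      have lHs: "linear (Hs x0)" and lHu: "linear (Hu x0)"
        using jet2_onD(2)[OF js xG] jet2_onD(2)[OF ju xG] has_derivative_linear by blast+
      have "minop B (gu x0) Hf \<le> 0"
        using has_derivative_linear[OF gf'] nsd sym psd B by (intro minop_nsd_le)
      \<comment> \<open>As \<open>gu x0\<close> is parallel to \<open>gs x0\<close>, the terms
        \<open>(k x0)^2 * k' * N'^2\<close> from the two summands of \<open>minop\<close> cancel,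
        and the terms cubic in \<open>k x0\<close> combine to \<open>E'\<close>.\<close>
      moreover have "minop B (gu x0) Hf = minop B (gu x0) (Hu x0) + k x0 * (T' + (k x0)^2 * E') + k' * N'"
      proof -
        have tr: "optrace (\<lambda>y. B (Hf y)) = optrace (\<lambda>y. B (Hu x0 y)) + k x0 * T' + k' * N'"
          using optrace_rank_one[OF linear_ident, of "gs x0" "B (gs x0)"]
          by (simp add: Hf_def linear_add[OF B] linear_cmul[OF B] optrace_add optrace_scaleR T'_def N'_def
              scaleR_scaleR[symmetric] del: scaleR_scaleR)
        have Bp: "B (gu x0) = - k x0 *\<^sub>R B (gs x0)" by (simp add: p linear_cmul[OF B] linear_neg[OF B])
        show ?thesis
          unfolding minop_def tr
          by (simp add: Bp Hf_def E'_def barrier_curvature_def N'_def[symmetric] T'_def[symmetric])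
             (simp add: p Hf_def linear_cmul[OF lHs] linear_neg[OF lHs] linear_cmul[OF lHu] linear_neg[OF lHu]
              inner_add_right inner_commute N'_def power2_eq_square algebra_simps)
      qed
      ultimately have "k x0 * (T' + (k x0)^2 * E') + k' * N' \<le> 0" using eq[OF xG] by simp
      \<comment> \<open>The negative powers of \<open>w\<close> factor out. The remaining bracket is
        positive by the lower bound on \<open>C^2 * E0\<close>, because
        \<open>w^2 \<le> R\<close>.\<close>
      moreover have "k x0 * (T' + (k x0)^2 * E') + k' * N' = (C / (8 * w^3)) * (4 * w^2 * T' + C^2 * E' - 2 * N')"
        using w by (simp add: k0 k'_def field_simps power2_eq_square power3_eq_cube)
      moreover have "C / (8 * w^3) > 0" using C w by simp
      ultimately have "4 * w^2 * T' + C^2 * E' - 2 * N' \<le> 0"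
        by (metis mult_le_0_iff not_less)
      moreover have "C^2 * E0 \<le> C^2 * E'" using E' by (intro mult_left_mono) auto
      moreover have "N' \<le> N0" using N x0 xG by (simp add: N'_def)
      moreover have "- (w^2 * T') \<le> R * T0"
      proof -
        have "\<bar>w^2 * T'\<bar> \<le> R * T0"
          unfolding abs_mult using T[OF x0 xG] sK[OF x0] w by (intro mult_mono) (auto simp: T'_def)
        then show ?thesis by linarith
      qed
      ultimately show False using C(2) by linarith
    qed
  qed
  then have "u x0 \<le> m" using m x0 by blast
  moreover have "C * sqrt (s x0 - \<delta>) \<le> C * sqrt R" using sK[OF x0] C by simp
  moreover have "u x \<le> f x" using sK[OF x] C by (simp add: f_def)
  ultimately show ?thesis using max[OF x] by (simp add: f_def)
qed

section \<open>The minimal surface system in terms of jets\<close>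

lemma partial_deriv_eq:
  assumes "(f has_derivative f') (at x)"
  shows "partial_deriv i f x = f' (axis i 1)"
  using frechet_derivative_at[OF assms] by (simp add: partial_deriv_def)

lemma Basis_vec_real: "(Basis :: (real^'n::finite) set) = range (\<lambda>i. axis i 1)"
  by (auto simp: Basis_vec_def)

lemma sum_Basis_vec:
  fixes h :: "real^'n::finite \<Rightarrow> 'b::comm_monoid_add"
  shows "(\<Sum>b\<in>Basis. h b) = (\<Sum>i\<in>UNIV. h (axis i 1))"
proof -
  have "inj (\<lambda>i::'n. axis i (1::real))" by (simp add: inj_on_def axis_eq_axis)
  then show ?thesis unfolding Basis_vec_real by (simp add: sum.reindex o_def)
qed

lemma has_derivative_gradient:
  fixes f :: "real^'n::finite \<Rightarrow> real"
  assumes "f differentiable (at x)"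
  shows "(f has_derivative (\<lambda>y. gradient f x \<bullet> y)) (at x)"
proof -
  let ?f' = "frechet_derivative f (at x)"
  have f': "(f has_derivative ?f') (at x)" using assms frechet_derivative_works by blast
  have "?f' y = gradient f x \<bullet> y" for y
  proof -
    have "?f' y = (\<Sum>b\<in>Basis. (y \<bullet> b) *\<^sub>R ?f' b)"
      using linear_sum[OF has_derivative_linear[OF f']] linear_cmul[OF has_derivative_linear[OF f']]
      by (metis (no_types, lifting) euclidean_representation sum.cong)
    then show ?thesis
      unfolding sum_Basis_vec inner_axis
      by (simp add: gradient_def partial_deriv_def inner_vec_def mult.commute)
  qed
  then show ?thesis using f' by presburger
qed

lemma gradient_eq:
  fixes f :: "real^'n::finite \<Rightarrow> real"
  assumes "(f has_derivative (\<lambda>y. g \<bullet> y)) (at x)"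
  shows "gradient f x = g"
  by (simp add: vec_eq_iff gradient_def partial_deriv_eq[OF assms] inner_axis)

text \<open>On an open set derivatives depend only on the values there. The induction runs over
  arbitrary pairs because the partial derivatives again agree on \<open>S\<close> only.\<close>

lemma Ck_on_cong:
  assumes "open S" "\<And>x. x \<in> S \<Longrightarrow> f x = g x" "Ck_on k S f"
  shows "Ck_on k S g"
  using assms(2,3)
proof (induction k arbitrary: f g)
  case 0
  then show ?case using continuous_on_cong by force
next
  case (Suc k)
  have d: "(g has_derivative frechet_derivative f (at x)) (at x)" if "x \<in> S" for x
  proof -
    have "f differentiable (at x)"
      using Suc.prems(2) that assms(1) by (auto simp: differentiable_on_eq_differentiable_at)
    then have "(f has_derivative frechet_derivative f (at x)) (at x)"
      using frechet_derivative_works by blast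
    then show ?thesis
      using has_derivative_transform_within_open[OF _ assms(1) that] Suc.prems(1) by blast
  qed
  have "partial_deriv i f x = partial_deriv i g x" if "x \<in> S" for i x
    using partial_deriv_eq[OF d[OF that]] by (simp add: partial_deriv_def)
  then have "Ck_on k S (partial_deriv i g)" for i
    using Suc.IH[of "partial_deriv i f" "partial_deriv i g"] Suc.prems(2) by simp
  moreover have "g differentiable_on S"
    using d assms(1) by (auto simp: differentiable_on_eq_differentiable_at differentiable_def)
  ultimately show ?case by simp
qed

lemma Ck_on_component:
  fixes u :: "real^'n::finite \<Rightarrow> real^'m::finite"
  assumes "open S" "Ck_on k S u"
  shows "Ck_on k S (\<lambda>x. u x $ a)"
  using assms(2)
proof (induction k arbitrary: u)
  case 0
  then show ?case by (auto intro!: continuous_intros)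
next
  case (Suc k)
  have d: "((\<lambda>x. u x $ a) has_derivative (\<lambda>y. frechet_derivative u (at x) y $ a)) (at x)" if "x \<in> S" for x
  proof -
    have "u differentiable (at x)"
      using Suc.prems that assms(1) by (auto simp: differentiable_on_eq_differentiable_at)
    then have "(u has_derivative frechet_derivative u (at x)) (at x)"
      using frechet_derivative_works by blast
    then show ?thesis using bounded_linear.has_derivative[OF bounded_linear_vec_nth] by blast
  qed
  have "partial_deriv i u x $ a = partial_deriv i (\<lambda>x. u x $ a) x" if "x \<in> S" for i x
    using partial_deriv_eq[OF d[OF that]] by (simp add: partial_deriv_def)
  then have "Ck_on k S (partial_deriv i (\<lambda>x. u x $ a))" for i
    using Ck_on_cong[OF assms(1) _ Suc.IH[of "partial_deriv i u"]] Suc.prems by simp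
  moreover have "(\<lambda>x. u x $ a) differentiable_on S"
    using d assms(1) by (auto simp: differentiable_on_eq_differentiable_at differentiable_def)
  ultimately show ?case by simp
qed

text \<open>Arranged as the derivative of the gradient in direction \<open>y\<close>; with this
  order of indices no symmetry of second derivatives enters.\<close>

definition hess :: "(real^'n::finite \<Rightarrow> real) \<Rightarrow> real^'n \<Rightarrow> real^'n \<Rightarrow> real^'n"
  where "hess f x y = (\<chi> j. \<Sum>i\<in>UNIV. y $ i * partial_deriv i (partial_deriv j f) x)"

lemma Ck_on_2_jet2_on:
  fixes f :: "real^'n::finite \<Rightarrow> real"
  assumes "open S" "Ck_on 2 S f"
  shows "jet2_on S f (gradient f) (hess f)"
  unfolding jet2_on_def
proof (intro ballI conjI)
  fix x assume x: "x \<in> S"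
  have 1: "f differentiable_on S" "\<And>j. partial_deriv j f differentiable_on S"
    using assms(2) by (auto simp: numeral_2_eq_2)
  then show "(f has_derivative (\<lambda>y. gradient f x \<bullet> y)) (at x)"
    using x assms(1) by (intro has_derivative_gradient) (auto simp: differentiable_on_eq_differentiable_at)
  have "(partial_deriv j f has_derivative (\<lambda>y. gradient (partial_deriv j f) x \<bullet> y)) (at x)" for j
    using 1 x assms(1) by (intro has_derivative_gradient) (auto simp: differentiable_on_eq_differentiable_at)
  then have "(partial_deriv j f has_derivative (\<lambda>y. hess f x y $ j)) (at x)" for j
    by (simp add: hess_def gradient_def inner_vec_def mult.commute)
  then have "((\<lambda>x. gradient f x $ j) has_derivative (\<lambda>y. hess f x y $ j)) (at x)" for j
    by (simp add: gradient_def)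
  then show "(gradient f has_derivative hess f x) (at x)"
    by (subst has_derivative_componentwise_within) (auto simp: Basis_vec_real inner_axis)
qed

lemma linear_hess: "linear (hess f x)"
  by (rule linearI)
     (simp_all add: hess_def vec_eq_iff algebra_simps sum.distrib sum_distrib_left)

lemma continuous_on_gradient:
  assumes "open S" "Ck_on 2 S f"
  shows "continuous_on S (gradient f)"
  using jet2_onD(2)[OF Ck_on_2_jet2_on[OF assms]]
  by (intro continuous_at_imp_continuous_on ballI has_derivative_continuous)

lemma continuous_on_hess:
  assumes "Ck_on 2 S f" "continuous_on S v"
  shows "continuous_on S (\<lambda>x. hess f x (v x))"
  using assms unfolding hess_def by (auto simp: numeral_2_eq_2 intro!: continuous_intros)

text \<open>Bridge from the coordinate form of the system to traces, on which the maximum principle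
  and the barriers operate.\<close>

lemma sum_matrix_hess:
  "(\<Sum>i\<in>UNIV. \<Sum>j\<in>UNIV. M $ i $ j * partial_deriv i (partial_deriv j f) x)
    = optrace (\<lambda>y. M *v hess f x y)"
proof -
  have "hess f x (axis i 1) $ j = partial_deriv i (partial_deriv j f) x" for i j
  proof -
    have "hess f x (axis i 1) $ j
        = (\<Sum>k\<in>UNIV. if k = i then partial_deriv k (partial_deriv j f) x else 0)"
      unfolding hess_def vec_lambda_beta by (intro sum.cong) (auto simp: axis_def)
    then show ?thesis by simp
  qed
  then show ?thesis
    unfolding optrace_def sum_Basis_vec inner_axis' by (simp add: matrix_vector_mult_def)
qed

section \<open>The graph metric and its inverse\<close>

lemma graph_metric_mult:
  "graph_metric u x *v y = y + (\<Sum>a\<in>UNIV. (gradient (\<lambda>z. u z $ a) x \<bullet> y) *\<^sub>R gradient (\<lambda>z. u z $ a) x)"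
proof -
  define P where "P a = gradient (\<lambda>z. u z $ a) x" for a
  have "(graph_metric u x *v y) $ i = y $ i + (\<Sum>a\<in>UNIV. (P a \<bullet> y) * P a $ i)" for i
  proof -
    have "(graph_metric u x *v y) $ i
        = (\<Sum>j\<in>UNIV. ((if i = j then 1 else 0) + (\<Sum>a\<in>UNIV. P a $ i * P a $ j)) * y $ j)"
      by (simp add: matrix_vector_mult_def graph_metric_def P_def gradient_def)
    also have "\<dots> = (\<Sum>j\<in>UNIV. if i = j then y $ j else 0) + (\<Sum>j\<in>UNIV. (\<Sum>a\<in>UNIV. P a $ i * P a $ j) * y $ j)"
      by (simp add: distrib_right sum.distrib mult_if_delta)
    also have "(\<Sum>j\<in>UNIV. (\<Sum>a\<in>UNIV. P a $ i * P a $ j) * y $ j) = (\<Sum>a\<in>UNIV. (P a \<bullet> y) * P a $ i)"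
      by (simp add: inner_vec_def sum_distrib_right sum_distrib_left sum.swap[of _ "UNIV :: 2 set"] ac_simps)
    finally show ?thesis by simp
  qed
  then show ?thesis by (simp add: vec_eq_iff P_def)
qed

text \<open>The metric is the identity plus a sum of rank-one squares, hence positive definite,
  injective and invertible. Symmetry and positivity pass to the inverse by substitution.\<close>

lemma
  fixes u :: "real^'n::finite \<Rightarrow> real^2"
  shows graph_metric_inv: "graph_metric u x *v (matrix_inv (graph_metric u x) *v y) = y"
    and inv_graph_metric: "matrix_inv (graph_metric u x) *v (graph_metric u x *v y) = y"
    and inv_graph_metric_symmetric:
      "v \<bullet> (matrix_inv (graph_metric u x) *v w) = (matrix_inv (graph_metric u x) *v v) \<bullet> w"
    and inv_graph_metric_pos: "y \<noteq> 0 \<Longrightarrow> y \<bullet> (matrix_inv (graph_metric u x) *v y) > 0"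
proof -
  let ?G = "graph_metric u x" and ?p = "\<lambda>a. gradient (\<lambda>z. u z $ a) x"
  have pos: "z \<bullet> (?G *v z) > 0" if "z \<noteq> 0" for z
  proof -
    have "z \<bullet> (?G *v z) = z \<bullet> z + (\<Sum>a\<in>UNIV. (?p a \<bullet> z)^2)"
      by (simp add: graph_metric_mult inner_add_right inner_sum_right inner_commute power2_eq_square)
    also have "\<dots> > 0" using that by (intro add_pos_nonneg sum_nonneg) auto
    finally show ?thesis .
  qed
  have sym: "v \<bullet> (?G *v w) = (?G *v v) \<bullet> w" for v w
    by (simp add: graph_metric_mult inner_add_right inner_add_left inner_sum_right inner_sum_left
        inner_commute mult.commute)
  have "inj ((*v) ?G)"
  proof (rule injI)
    fix v w assume "?G *v v = ?G *v w"
    then have "(v - w) \<bullet> (?G *v (v - w)) = 0" by (simp add: matrix_vector_mult_diff_distrib)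
    then show "v = w" using pos[of "v - w"] by force
  qed
  then have "invertible ?G"
    by (simp add: invertible_left_inverse matrix_left_invertible_injective)
  \<comment> \<open>\<open>matrix_inv\<close> is a choice operator; its inverse property comes from
    the existence of some inverse.\<close>
  then have "?G ** matrix_inv ?G = mat 1 \<and> matrix_inv ?G ** ?G = mat 1"
    unfolding invertible_def matrix_inv_def by (rule someI_ex)
  then have inv: "?G ** matrix_inv ?G = mat 1" "matrix_inv ?G ** ?G = mat 1" by auto
  show 1: "?G *v (matrix_inv ?G *v y) = y" "matrix_inv ?G *v (?G *v y) = y" for y
    by (simp_all add: matrix_vector_mul_assoc inv)
  show "v \<bullet> (matrix_inv ?G *v w) = (matrix_inv ?G *v v) \<bullet> w"
    using sym[of "matrix_inv ?G *v v" "matrix_inv ?G *v w"] by (simp add: 1)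
  show "y \<bullet> (matrix_inv ?G *v y) > 0" if "y \<noteq> 0"
  proof -
    have "matrix_inv ?G *v y \<noteq> 0" using 1(1)[of y] that by force
    from pos[OF this] show ?thesis by (simp add: 1 inner_commute)
  qed
qed

text \<open>Adding \<open>e * (x \<bullet> x)\<close> makes the inequality strict: at an interior
  maximum of \<open>h\<close> the trace would be nonpositive and yet equal to
  \<open>2 * e * optrace (M x0)\<close>. Ellipticity enters pointwise, so \<open>M\<close> may
  degenerate at the boundary, where the gradient of a solution is not controlled.\<close>

lemma weak_maximum_principle:
  fixes f :: "'a::euclidean_space \<Rightarrow> real"
  assumes \<Omega>: "open \<Omega>" "bounded \<Omega>" and cf: "continuous_on (closure \<Omega>) f"
    and jf: "jet2_on \<Omega> f g H"
    and M: "\<And>x. x \<in> \<Omega> \<Longrightarrow> linear (M x)" "\<And>x v w. x \<in> \<Omega> \<Longrightarrow> v \<bullet> M x w = M x v \<bullet> w"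
      "\<And>x y. x \<in> \<Omega> \<Longrightarrow> y \<noteq> 0 \<Longrightarrow> y \<bullet> M x y > 0"
    and eq: "\<And>x. x \<in> \<Omega> \<Longrightarrow> optrace (\<lambda>y. M x (H x y)) = 0"
    and bd: "\<And>x. x \<in> frontier \<Omega> \<Longrightarrow> f x \<le> 0"
    and x: "x \<in> closure \<Omega>"
  shows "f x \<le> 0"
proof -
  have comp: "compact (closure \<Omega>)" using \<Omega> by (simp add: compact_closure)
  obtain R where R: "\<And>x. x \<in> closure \<Omega> \<Longrightarrow> norm x \<le> R" "R > 0"
    using compact_imp_bounded[OF comp] bounded_pos by metis
  have le: "f x \<le> e * R^2" if e: "e > 0" for e
  proof -
    define h where "h x = f x + e * (x \<bullet> x)" for x
    have "continuous_on (closure \<Omega>) h" unfolding h_def by (intro continuous_intros cf)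
    moreover have "closure \<Omega> \<noteq> {}" using x by (metis empty_iff)
    ultimately obtain x0 where x0: "x0 \<in> closure \<Omega>" and max: "\<And>y. y \<in> closure \<Omega> \<Longrightarrow> h y \<le> h x0"
      using continuous_attains_sup[OF comp, of h] by blast
    have "x0 \<notin> \<Omega>"
    proof
      assume x0': "x0 \<in> \<Omega>"
      have h': "(h has_derivative (\<lambda>y. (g x + (2 * e) *\<^sub>R x) \<bullet> y)) (at x)" if "x \<in> \<Omega>" for x
        unfolding h_def using that
        by (auto simp: inner_add_left inner_commute algebra_simps
            intro!: derivative_eq_intros jet2_onD(1)[OF jf])
      have g': "((\<lambda>x. g x + (2 * e) *\<^sub>R x) has_derivative (\<lambda>y. H x0 y + (2 * e) *\<^sub>R y)) (at x0)"
        by (auto intro!: derivative_eq_intros jet2_onD(2)[OF jf] x0')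
      have nsd: "y \<bullet> (H x0 y + (2 * e) *\<^sub>R y) \<le> 0" for y
        using second_order_max(2)[OF \<Omega>(1) x0' h' g'] max closure_subset by blast
      have M0: "linear (M x0)" by (rule M(1)[OF x0'])
      have "optrace (\<lambda>y. M x0 (H x0 y + (2 * e) *\<^sub>R y)) \<le> 0"
      proof (rule optrace_psd_nsd_le[OF M0 has_derivative_linear[OF g'] M(2)[OF x0'] _ nsd])
        show "y \<bullet> M x0 y \<ge> 0" for y
          using M(3)[OF x0', of y] by (cases "y = 0") auto
      qed
      then have "2 * e * optrace (M x0) \<le> 0"
        using eq[OF x0'] by (simp add: linear_add[OF M0] linear_cmul[OF M0] optrace_add optrace_scaleR)
      moreover have "optrace (M x0) > 0"
        unfolding optrace_def by (intro sum_pos M(3)[OF x0'] nonzero_Basis) auto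
      ultimately show False using e by (simp add: mult_le_0_iff)
    qed
    then have "f x0 \<le> 0" using bd x0 \<Omega>(1) by (simp add: frontier_def interior_open)
    moreover have "e * (x0 \<bullet> x0) \<le> e * R^2"
      using R(1)[OF x0] e by (simp add: power2_norm_eq_inner[symmetric] power_mono)
    moreover have "f x \<le> h x" using e by (simp add: h_def)
    ultimately show ?thesis using max[OF x] by (simp add: h_def)
  qed
  show ?thesis
  proof (rule ccontr)
    assume "\<not> f x \<le> 0"
    \<comment> \<open>For this \<open>e\<close> the estimate reads
      \<open>f x \<le> f x / 2\<close>.\<close>
    then show False using le[of "f x / (2 * R^2)"] R by (simp add: field_simps)
  qed
qed

section \<open>Reduction of the system to a scalar equation\<close>

lemma jet2_on_diff_linear:
  assumes "jet2_on S f g H"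
  shows "jet2_on S (\<lambda>x. f x - a \<bullet> x) (\<lambda>x. g x - a) H"
  using assms unfolding jet2_on_def
  by (auto simp: inner_diff_left intro!: derivative_eq_intros)

lemma jet2_on_uminus:
  assumes "jet2_on S f g H"
  shows "jet2_on S (\<lambda>x. - f x) (\<lambda>x. - g x) (\<lambda>x y. - H x y)"
  using assms unfolding jet2_on_def
  by (auto intro!: derivative_eq_intros)

lemma solution_component:
  assumes \<Omega>: "open \<Omega>" and u: "classical_solution \<Omega> \<psi> u"
  shows "jet2_on \<Omega> (\<lambda>x. u x $ a) (gradient (\<lambda>x. u x $ a)) (hess (\<lambda>x. u x $ a))"
    and "continuous_on (closure \<Omega>) (\<lambda>x. u x $ a)"
    and "x \<in> \<Omega> \<Longrightarrow> optrace (\<lambda>y. matrix_inv (graph_metric u x) *v hess (\<lambda>x. u x $ a) x y) = 0"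
    and "x \<in> frontier \<Omega> \<Longrightarrow> u x $ a = \<psi> x $ a"
  using u unfolding classical_solution_def minimal_surface_system_on_def sum_matrix_hess
  by (auto intro!: Ck_on_2_jet2_on Ck_on_component \<Omega> continuous_intros)

text \<open>Linear functions solve every equation \<open>g\<^sup>i\<^sup>j \<partial>\<^sub>i \<partial>\<^sub>j f = 0\<close>, whatever the coefficients.\<close>

lemma solution_component_linear:
  assumes \<Omega>: "open \<Omega>" "bounded \<Omega>" and u: "classical_solution \<Omega> \<psi> u"
    and lin: "\<And>x. x \<in> frontier \<Omega> \<Longrightarrow> \<psi> x $ a = l \<bullet> x"
    and x: "x \<in> \<Omega>"
  shows "gradient (\<lambda>x. u x $ a) x = l"
proof -
  note s = solution_component[OF \<Omega>(1) u, where a = a]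
  define f where "f x = u x $ a - l \<bullet> x" for x
  have jf: "jet2_on \<Omega> f (\<lambda>x. gradient (\<lambda>x. u x $ a) x - l) (hess (\<lambda>x. u x $ a))"
    unfolding f_def by (rule jet2_on_diff_linear[OF s(1)])
  have cf: "continuous_on (closure \<Omega>) f" unfolding f_def by (intro continuous_intros s(2))
  have bd: "f x = 0" if "x \<in> frontier \<Omega>" for x using s(4) lin that by (simp add: f_def)
  \<comment> \<open>The coefficients depend on \<open>u\<close>, but for a fixed solution they form
    a positive definite matrix field, so the linear maximum principle applies to \<open>f\<close>
    and to \<open>- f\<close>.\<close>
  let ?M = "\<lambda>x y. matrix_inv (graph_metric u x) *v y"
  have "f x \<le> 0" if "x \<in> closure \<Omega>" for x
    by (rule weak_maximum_principle[OF \<Omega> cf jf, of ?M])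
       (auto simp: s(3) bd that intro: inv_graph_metric_pos inv_graph_metric_symmetric)
  moreover have "- f x \<le> 0" if "x \<in> closure \<Omega>" for x
    by (rule weak_maximum_principle[OF \<Omega> continuous_on_minus[OF cf] jet2_on_uminus[OF jf], of ?M])
       (auto simp: s(3) bd that linear_neg[OF matrix_vector_mul_linear] optrace_scaleR[of "-1", simplified]
         intro: inv_graph_metric_pos inv_graph_metric_symmetric)
  ultimately have "u x $ a = l \<bullet> x" if "x \<in> \<Omega>" for x
    using that closure_subset[of \<Omega>] by (force simp: f_def)
  moreover have "((\<lambda>x. l \<bullet> x) has_derivative (\<lambda>y. l \<bullet> y)) (at x)"
    by (auto intro!: derivative_eq_intros)
  ultimately have "((\<lambda>x. u x $ a) has_derivative (\<lambda>y. l \<bullet> y)) (at x)"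
    using has_derivative_transform_within_open[OF _ \<Omega>(1) x] by force
  then show ?thesis by (rule gradient_eq)
qed

text \<open>For \<open>c = \<epsilon>\<^sup>2 / (1 + \<epsilon>\<^sup>2)\<close> and a unit vector \<open>e\<close> this is the inverse of \<open>I + \<epsilon>\<^sup>2 e e\<^sup>T\<close>.\<close>

definition shrink :: "'a::real_inner \<Rightarrow> real \<Rightarrow> 'a \<Rightarrow> 'a"
  where "shrink e c y = y - (c * (e \<bullet> y)) *\<^sub>R e"

lemma linear_shrink: "linear (shrink e c)"
  by (rule linearI) (simp_all add: shrink_def algebra_simps inner_add_right)

lemma shrink_symmetric: "x \<bullet> shrink e c y = shrink e c x \<bullet> y"
  by (simp add: shrink_def inner_diff_left inner_diff_right inner_commute)

lemma shrink_lower_bound: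
  assumes "norm e = 1" "0 \<le> c"
  shows "(1 - c) * (y \<bullet> y) \<le> y \<bullet> shrink e c y"
proof -
  have "(e \<bullet> y)^2 \<le> y \<bullet> y"
    using Cauchy_Schwarz_ineq[of e y] assms(1) by (simp add: norm_eq_1)
  then have "c * (e \<bullet> y)^2 \<le> c * (y \<bullet> y)" using assms(2) by (rule mult_left_mono)
  then show ?thesis
    by (simp add: shrink_def inner_diff_right inner_commute power2_eq_square algebra_simps)
qed

lemma optrace_shrink:
  assumes "linear H"
  shows "optrace (\<lambda>y. shrink e c (H y)) = optrace H - c * (e \<bullet> H e)"
  using optrace_rank_one[OF assms, of e "c *\<^sub>R e"] linear_cmul[OF assms]
  by (simp add: shrink_def optrace_diff mult.commute)

text \<open>With the first gradient constant, the graph metric is \<open>A + p p^T\<close>, where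
  \<open>A = I + \<epsilon>^2 e e^T\<close> has the inverse \<open>B\<close>. Sherman-Morrison
  inverts the sum, and the positive factor \<open>1 + d\<close> clears the denominator.\<close>

lemma second_component_equation:
  fixes u :: "real^'n::finite \<Rightarrow> real^2"
  assumes \<Omega>: "open \<Omega>" and u: "classical_solution \<Omega> \<psi> u"
    and x: "x \<in> \<Omega>" and g1: "gradient (\<lambda>x. u x $ 1) x = \<epsilon> *\<^sub>R e" and e: "norm e = 1"
  shows "minop (shrink e (\<epsilon>^2 / (1 + \<epsilon>^2))) (gradient (\<lambda>x. u x $ 2) x) (hess (\<lambda>x. u x $ 2) x) = 0"
proof -
  define c where "c = \<epsilon>^2 / (1 + \<epsilon>^2)"
  define B where "B = shrink e c"
  define p where "p = gradient (\<lambda>x. u x $ 2) x"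
  define H where "H = hess (\<lambda>x. u x $ 2) x"
  define d where "d = p \<bullet> B p"
  have pe: "1 + \<epsilon>^2 > 0" by (simp add: add_pos_nonneg)
  have c: "c \<ge> 0" "c < 1" "\<epsilon>^2 * (1 - c) = c" using pe by (auto simp: c_def field_simps)
  have d: "d \<ge> 0"
    using order_trans[OF _ shrink_lower_bound[OF e c(1), of p]] c by (simp add: d_def B_def)
  have G: "graph_metric u x *v y = y + (\<epsilon>^2 * (e \<bullet> y)) *\<^sub>R e + (p \<bullet> y) *\<^sub>R p" for y
    by (simp add: graph_metric_mult sum_2 g1 p_def power2_eq_square)
  have "e \<bullet> B y = (1 - c) * (e \<bullet> y)" for y
    using e by (simp add: B_def shrink_def inner_diff_right norm_eq_1 algebra_simps)
  \<comment> \<open>The relation \<open>\<epsilon>^2 * (1 - c) = c\<close> cancels the terms along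
    \<open>e\<close>, so that \<open>B\<close> inverts the constant part of the metric.\<close>
  then have "\<epsilon>^2 * (e \<bullet> B y) = c * (e \<bullet> y)" for y using c(3) by (metis mult.assoc)
  then have GB: "graph_metric u x *v B y = y + (p \<bullet> B y) *\<^sub>R p" for y
    by (simp add: G) (simp add: B_def shrink_def)
  define M where "M y = B y - ((B p \<bullet> y) / (1 + d)) *\<^sub>R B p" for y
  have "graph_metric u x *v M y = y" for y
  proof -
    have "graph_metric u x *v M y = y + (p \<bullet> B y) *\<^sub>R p - ((B p \<bullet> y) / (1 + d)) *\<^sub>R (p + d *\<^sub>R p)"
      by (simp add: M_def matrix_vector_mult_diff_distrib matrix_vector_mult_scaleR GB d_def)
    also have "p + d *\<^sub>R p = (1 + d) *\<^sub>R p" by (simp add: scaleR_add_left)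
    also have "((B p \<bullet> y) / (1 + d)) *\<^sub>R (1 + d) *\<^sub>R p = (B p \<bullet> y) *\<^sub>R p" using d by simp
    also have "B p \<bullet> y = p \<bullet> B y" by (simp add: B_def shrink_symmetric)
    finally show ?thesis by simp
  qed
  then have "matrix_inv (graph_metric u x) *v y = M y" for y
    using inv_graph_metric[of u x "M y"] by simp
  then have "optrace (\<lambda>y. M (H y)) = 0"
    using solution_component(3)[OF \<Omega> u x, where a = 2] by (simp add: H_def)
  moreover have "optrace (\<lambda>y. M (H y)) = optrace (\<lambda>y. B (H y)) - (B p \<bullet> H (B p)) / (1 + d)"
  proof -
    have "optrace (\<lambda>y. ((B p \<bullet> H y) / (1 + d)) *\<^sub>R B p) = (B p \<bullet> H (B p)) / (1 + d)"
      using optrace_rank_one[OF linear_hess, of "B p" "\<lambda>x. u x $ 2" x "B p"]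
        optrace_scaleR[of "1 / (1 + d)" "\<lambda>y. (B p \<bullet> H y) *\<^sub>R B p"] by (simp add: H_def)
    then show ?thesis by (simp add: M_def optrace_diff)
  qed
  ultimately have "(1 + d) * optrace (\<lambda>y. B (H y)) - B p \<bullet> H (B p) = 0" using d by (simp add: field_simps)
  then show ?thesis by (simp add: minop_def d_def B_def p_def H_def c_def)
qed

section \<open>Curvature of the boundary in terms of a defining function\<close>

text \<open>If the unit vectors differed, their difference \<open>v\<close> would have a positive
  product with \<open>a\<close> and a negative one with \<open>b\<close>.\<close>

lemma sgn_eq_sgn_if_half_space:
  fixes a b :: "'a::real_inner"
  assumes "a \<noteq> 0" "b \<noteq> 0" and half: "\<And>v. a \<bullet> v > 0 \<Longrightarrow> b \<bullet> v \<ge> 0"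
  shows "sgn a = sgn b"
proof (rule ccontr)
  assume neq: "sgn a \<noteq> sgn b"
  define v where "v = sgn a - sgn b"
  have n: "norm (sgn a) = 1" "norm (sgn b) = 1" using assms by (simp_all add: norm_sgn)
  then have nn: "sgn a \<bullet> sgn a = 1" "sgn b \<bullet> sgn b = 1" by (simp_all add: norm_eq_1)
  have "v \<bullet> v > 0" using neq by (simp add: v_def)
  then have lt: "sgn a \<bullet> sgn b < 1" by (simp add: v_def inner_diff_left inner_diff_right nn inner_commute)
  have ab: "a = norm a *\<^sub>R sgn a" "b = norm b *\<^sub>R sgn b" using assms by (simp_all add: sgn_div_norm)
  have "a \<bullet> v = norm a * (1 - sgn a \<bullet> sgn b)"
    by (subst ab(1)) (simp add: v_def inner_diff_right nn algebra_simps)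
  then have "a \<bullet> v > 0" using lt assms by simp
  from half[OF this] have "b \<bullet> v \<ge> 0" .
  moreover have "b \<bullet> v = norm b * (sgn a \<bullet> sgn b - 1)"
    by (subst ab(2)) (simp add: v_def inner_diff_right nn inner_commute algebra_simps)
  ultimately show False using lt assms by (simp add: zero_le_mult_iff)
qed

lemma local_defining_functionD:
  assumes "local_defining_function \<Omega> p U r"
  shows "open U" "p \<in> U" "Ck_on 2 U r" "\<And>x. x \<in> U \<Longrightarrow> gradient r x \<noteq> 0"
    "\<And>x. x \<in> U \<Longrightarrow> x \<in> \<Omega> \<longleftrightarrow> r x > 0" "\<And>x. x \<in> U \<Longrightarrow> x \<in> frontier \<Omega> \<longleftrightarrow> r x = 0"
    "jet2_on U r (gradient r) (hess r)"
  using assms Ck_on_2_jet2_on[of U r]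
  by (auto simp: local_defining_function_def smooth_on_def)

section \<open>Inner normal and tangential derivatives\<close>

lemma eventually_in_open:
  assumes "open U" "(x::'a::real_normed_vector) \<in> U"
  shows "\<forall>\<^sub>F t in at_right 0. x + t *\<^sub>R v \<in> U"
proof -
  have "((\<lambda>t. x + t *\<^sub>R v) \<longlongrightarrow> x) (at_right 0)" by (auto intro!: tendsto_eq_intros)
  then show ?thesis using assms by (rule topological_tendstoD)
qed

text \<open>The description by \<open>THE\<close> is well defined: a direction in which
  \<open>r\<close> increases leads into \<open>\<Omega>\<close>, where any other defining function
  is positive too, so its gradient has a nonnegative product with that direction.\<close>

lemma inner_normal_eq:
  assumes r: "local_defining_function \<Omega> p U r" and p: "p \<in> frontier \<Omega>"
  shows "inner_normal \<Omega> p = sgn (gradient r p)"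
proof -
  note rD = local_defining_functionD[OF r]
  have "sgn (gradient r' p) = sgn (gradient r p)" if r': "local_defining_function \<Omega> p U' r'" for U' r'
  proof (rule sym, rule sgn_eq_sgn_if_half_space)
    note rD' = local_defining_functionD[OF r']
    have p0: "r p = 0" "r' p = 0" using rD(2,6) rD'(2,6) p by auto
    show "gradient r p \<noteq> 0" "gradient r' p \<noteq> 0" using rD rD' by auto
    show "gradient r' p \<bullet> v \<ge> 0" if v: "gradient r p \<bullet> v > 0" for v
    proof (rule ccontr)
      assume "\<not> gradient r' p \<bullet> v \<ge> 0"
      then have neg: "0 < (- gradient r' p) \<bullet> v" by simp
      have 1: "\<forall>\<^sub>F t in at_right 0. r p + t * 0 < r (p + t *\<^sub>R v)"
        by (rule eventually_above_line[OF jet2_onD(1)[OF rD(7,2)] v])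
      have "((\<lambda>x. - r' x) has_derivative (\<lambda>y. (- gradient r' p) \<bullet> y)) (at p)"
        using jet2_onD(1)[OF rD'(7,2)] by (auto intro!: derivative_eq_intros)
      from eventually_above_line[OF this neg]
      have 2: "\<forall>\<^sub>F t in at_right 0. - r' p + t * 0 < - r' (p + t *\<^sub>R v)" .
      have "\<forall>\<^sub>F t in at_right 0. 0 < r (p + t *\<^sub>R v) \<and> r' (p + t *\<^sub>R v) < 0 \<and> p + t *\<^sub>R v \<in> U \<and> p + t *\<^sub>R v \<in> U'"
        using 1 2 eventually_in_open[OF rD(1,2), of v] eventually_in_open[OF rD'(1,2), of v]
        by eventually_elim (simp add: p0)
      then obtain t where "0 < r (p + t *\<^sub>R v)" "r' (p + t *\<^sub>R v) < 0" "p + t *\<^sub>R v \<in> U" "p + t *\<^sub>R v \<in> U'"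
        using eventually_happens'[OF trivial_limit_at_right_real] by blast
      then show False using rD(5) rD'(5) by (metis not_less_iff_gr_or_eq)
    qed
  qed
  then show ?thesis unfolding inner_normal_def using r by (intro the_equality) blast+
qed

text \<open>The implicit function theorem in weak form: to first order the boundary contains every
  tangent direction.\<close>

lemma frontier_point_near_tangent:
  assumes r: "local_defining_function \<Omega> p U r" and p: "p \<in> frontier \<Omega>"
    and \<nu>: "\<nu> = sgn (gradient r p)" and v: "v \<bullet> \<nu> = 0" and h: "h > 0"
  shows "\<forall>\<^sub>F t in at_right 0. \<exists>s. \<bar>s\<bar> \<le> h * t \<and> p + t *\<^sub>R v + s *\<^sub>R \<nu> \<in> frontier \<Omega>"
proof -
  note rD = local_defining_functionD[OF r]
  define g where "g = gradient r p"
  have g: "g \<noteq> 0" using rD by (simp add: g_def)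
  have g\<nu>: "g = norm g *\<^sub>R \<nu>" using g by (simp add: \<nu> g_def sgn_div_norm)
  have n\<nu>: "\<nu> \<bullet> \<nu> = 1" using g by (simp add: \<nu> g_def norm_eq_1[symmetric] norm_sgn)
  have "\<nu> \<bullet> v = 0" using v by (metis inner_commute)
  then have "g \<bullet> v = 0" by (subst g\<nu>) simp
  moreover have "g \<bullet> \<nu> = norm g" by (subst g\<nu>) (simp add: n\<nu>)
  \<comment> \<open>Tilting the tangent vector by \<open>h\<close> towards either side of the
    boundary gives \<open>r\<close> opposite strict signs; the intermediate value theorem on the
    segment between the tilted points then yields a zero of \<open>r\<close>.\<close>
  ultimately have gg: "0 < g \<bullet> (v + h *\<^sub>R \<nu>)" "0 < (- g) \<bullet> (v - h *\<^sub>R \<nu>)"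
    using g h by (simp_all add: inner_add_right inner_diff_right)
  have p0: "r p = 0" using rD(2,6) p by auto
  have 1: "\<forall>\<^sub>F t in at_right 0. r p + t * 0 < r (p + t *\<^sub>R (v + h *\<^sub>R \<nu>))"
    by (rule eventually_above_line[OF jet2_onD(1)[OF rD(7,2)] gg(1)[unfolded g_def]])
  have "((\<lambda>x. - r x) has_derivative (\<lambda>y. (- g) \<bullet> y)) (at p)"
    using jet2_onD(1)[OF rD(7,2)] by (auto simp: g_def intro!: derivative_eq_intros)
  from eventually_above_line[OF this gg(2)]
  have 2: "\<forall>\<^sub>F t in at_right 0. - r p + t * 0 < - r (p + t *\<^sub>R (v - h *\<^sub>R \<nu>))" .
  obtain e where e: "e > 0" "ball p e \<subseteq> U" using rD(1,2) open_contains_ball by blast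
  have 3: "\<forall>\<^sub>F t in at_right 0. t * (norm v + h) < e"
    using e by (intro order_tendstoD(2)[of _ 0]) (auto intro!: tendsto_eq_intros)
  have 4: "\<forall>\<^sub>F t in at_right (0::real). 0 < t" by (rule eventually_at_right_less)
  show ?thesis using 1 2 3 4
  proof eventually_elim
    case (elim t)
    have inU: "p + t *\<^sub>R v + s *\<^sub>R \<nu> \<in> U" if "\<bar>s\<bar> \<le> h * t" for s
    proof -
      have "norm (t *\<^sub>R v + s *\<^sub>R \<nu>) \<le> t * norm v + \<bar>s\<bar>"
        using elim(4) n\<nu> norm_triangle_ineq[of "t *\<^sub>R v" "s *\<^sub>R \<nu>"] by (simp add: norm_eq_1[symmetric])
      also have "\<dots> \<le> t * (norm v + h)" using that by (simp add: algebra_simps)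
      also have "\<dots> < e" by (rule elim(3))
      finally have "dist p (p + t *\<^sub>R v + s *\<^sub>R \<nu>) < e"
        using norm_minus_cancel[of "t *\<^sub>R v + s *\<^sub>R \<nu>"] by (simp add: dist_norm)
      then show ?thesis using e by auto
    qed
    have "continuous_on {- (h * t)..h * t} (\<lambda>s. r (p + t *\<^sub>R v + s *\<^sub>R \<nu>))"
    proof (rule continuous_on_compose2[of U r])
      show "continuous_on U r"
        using jet2_onD(1)[OF rD(7)] by (intro continuous_at_imp_continuous_on ballI has_derivative_continuous)
      show "(\<lambda>s. p + t *\<^sub>R v + s *\<^sub>R \<nu>) ` {- (h * t)..h * t} \<subseteq> U"
        using inU by (auto simp: abs_le_iff)
    qed (intro continuous_intros)
    moreover have "r (p + t *\<^sub>R v + (- (h * t)) *\<^sub>R \<nu>) \<le> 0" "0 \<le> r (p + t *\<^sub>R v + (h * t) *\<^sub>R \<nu>)"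
      using elim p0 by (simp_all add: algebra_simps)
    ultimately obtain s where s: "- (h * t) \<le> s" "s \<le> h * t" "r (p + t *\<^sub>R v + s *\<^sub>R \<nu>) = 0"
      using IVT'[of "\<lambda>s. r (p + t *\<^sub>R v + s *\<^sub>R \<nu>)" "- (h * t)" 0 "h * t"] elim(4) h by auto
    then show ?case using rD(6)[OF inU[of s]] by (intro exI[of _ s]) auto
  qed
qed

text \<open>The difference \<open>D\<close> of the derivatives is a derivative of 0, hence
  \<open>o(norm (y - p))\<close> along the boundary. Boundary points
  \<open>p + t v + s \<nu>\<close> with \<open>\<bar>s\<bar> \<le> e * t\<close> then bound
  \<open>D v\<close> by a multiple of \<open>e\<close>.\<close>

lemma derivative_within_frontier_unique:
  assumes r: "local_defining_function \<Omega> p U r" and p: "p \<in> frontier \<Omega>"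
    and v: "v \<bullet> inner_normal \<Omega> p = 0"
    and L: "(f has_derivative L) (at p within frontier \<Omega>)" "(f has_derivative L') (at p within frontier \<Omega>)"
  shows "L v = L' v"
proof -
  define D where "D x = L x - L' x" for x
  define \<nu> where "\<nu> = sgn (gradient r p)"
  have \<nu>: "norm \<nu> = 1" using local_defining_functionD(2,4)[OF r] by (simp add: \<nu>_def norm_sgn)
  have v: "v \<bullet> \<nu> = 0" using v by (simp add: inner_normal_eq[OF r p] \<nu>_def)
  have D: "((\<lambda>x. 0) has_derivative D) (at p within frontier \<Omega>)"
    using has_derivative_diff[OF L] by (simp add: D_def[abs_def])
  have lD: "linear D" using D by (rule has_derivative_linear)
  have le: "norm (D v) \<le> e * (norm (D \<nu>) + norm v + 1)" if e: "0 < e" "e \<le> 1" for e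
  proof -
    obtain d where d: "d > 0" "\<And>y. y \<in> frontier \<Omega> \<Longrightarrow> norm (y - p) < d \<Longrightarrow> norm (D (y - p)) \<le> e * norm (y - p)"
      using D e unfolding has_derivative_within_alt by force
    have "\<forall>\<^sub>F t in at_right 0. t * (norm v + 1) < d"
      using d by (intro order_tendstoD(2)[of _ 0]) (auto intro!: tendsto_eq_intros)
    moreover note frontier_point_near_tangent[OF r p \<nu>_def v e(1)]
    moreover have "\<forall>\<^sub>F t in at_right (0::real). 0 < t" by (rule eventually_at_right_less)
    ultimately have "\<forall>\<^sub>F t in at_right 0. t * (norm v + 1) < d \<and> 0 < t \<and>
        (\<exists>s. \<bar>s\<bar> \<le> e * t \<and> p + t *\<^sub>R v + s *\<^sub>R \<nu> \<in> frontier \<Omega>)"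
      by eventually_elim blast
    then obtain t s where ts: "t * (norm v + 1) < d" "0 < t" "\<bar>s\<bar> \<le> e * t"
        "p + t *\<^sub>R v + s *\<^sub>R \<nu> \<in> frontier \<Omega>"
      using eventually_happens'[OF trivial_limit_at_right_real] by blast
    have "e * t \<le> 1 * t" using e ts(2) by (intro mult_right_mono) auto
    then have st: "\<bar>s\<bar> \<le> t" using ts(3) by simp
    define w where "w = t *\<^sub>R v + s *\<^sub>R \<nu>"
    have w: "norm w \<le> t * (norm v + 1)"
      using norm_triangle_ineq[of "t *\<^sub>R v" "s *\<^sub>R \<nu>"] \<nu> st ts(2) by (simp add: w_def algebra_simps)
    have "norm (D w) \<le> e * norm w"
      using d(2)[OF ts(4)] w ts(1) by (simp add: w_def add.assoc)
    also have "\<dots> \<le> e * (t * (norm v + 1))" using w e by (intro mult_left_mono) auto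
    finally have Dw: "norm (D w) \<le> e * (t * (norm v + 1))" .
    have "t *\<^sub>R D v = D w - s *\<^sub>R D \<nu>"
      by (simp add: w_def linear_add[OF lD] linear_cmul[OF lD])
    then have "t * norm (D v) = norm (D w - s *\<^sub>R D \<nu>)" using ts(2) by (metis abs_of_pos norm_scaleR)
    also have "\<dots> \<le> e * (t * (norm v + 1)) + (e * t) * norm (D \<nu>)"
      using norm_triangle_ineq4[of "D w" "s *\<^sub>R D \<nu>"] Dw mult_right_mono[OF ts(3), of "norm (D \<nu>)"] by simp
    also have "\<dots> = t * (e * (norm (D \<nu>) + norm v + 1))" by (simp add: algebra_simps)
    finally show ?thesis using ts(2) by simp
  qed
  define k where "k = norm (D \<nu>) + norm v + 1"
  have k: "k > 0" by (simp add: k_def add_nonneg_pos)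
  have "D v = 0"
  proof (rule ccontr)
    assume "D v \<noteq> 0"
    define e where "e = min 1 (norm (D v) / (2 * k))"
    have e: "0 < e" "e \<le> 1" using k \<open>D v \<noteq> 0\<close> by (auto simp: e_def)
    have "norm (D v) \<le> e * k" using le[OF e] by (simp add: k_def)
    also have "\<dots> \<le> norm (D v) / (2 * k) * k" using k by (intro mult_right_mono) (auto simp: e_def)
    finally show False using k \<open>D v \<noteq> 0\<close> by simp
  qed
  then show ?thesis by (simp add: D_def)
qed

section \<open>Shape operator and principal curvatures\<close>

lemma has_derivative_sgn:
  fixes g :: "'a::euclidean_space \<Rightarrow> 'b::euclidean_space"
  assumes g: "(g has_derivative H) (at x)" and "g x \<noteq> 0"
  shows "((\<lambda>x. sgn (g x)) has_derivative
    (\<lambda>y. (1 / norm (g x)) *\<^sub>R (H y - (sgn (g x) \<bullet> H y) *\<^sub>R sgn (g x)))) (at x)"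
proof -
  have "((\<lambda>x. inverse (norm (g x)) *\<^sub>R g x) has_derivative
    (\<lambda>y. (1 / norm (g x)) *\<^sub>R (H y - (sgn (g x) \<bullet> H y) *\<^sub>R sgn (g x)))) (at x)"
    using assms(2)
    by (auto intro!: derivative_eq_intros g has_derivative_compose[OF g has_derivative_norm]
        simp: fun_eq_iff sgn_div_norm divide_simps algebra_simps inner_commute)
  then show ?thesis by (simp add: sgn_div_norm)
qed

text \<open>\<open>r\<close> is a defining function at all boundary points near \<open>p\<close>, so
  the inner normal there is the normalized gradient, with differential \<open>- W\<close>.
  Uniqueness on tangent vectors removes the choice of \<open>L\<close> in the definition.\<close>

lemma principal_space_eq:
  assumes r: "local_defining_function \<Omega> p U r" and p: "p \<in> frontier \<Omega>"
    and \<nu>: "\<nu> = sgn (gradient r p)"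
    and W: "W = (\<lambda>y. (- 1 / norm (gradient r p)) *\<^sub>R (hess r p y - (\<nu> \<bullet> hess r p y) *\<^sub>R \<nu>))"
  shows "principal_space \<Omega> p k = {v \<in> {v. \<nu> \<bullet> v = 0}. W v = k *\<^sub>R v}"
proof -
  note rD = local_defining_functionD[OF r]
  have \<nu>p: "inner_normal \<Omega> p = \<nu>" using inner_normal_eq[OF r p] \<nu> by simp
  have "((\<lambda>x. sgn (gradient r x)) has_derivative (\<lambda>y. - W y)) (at p within frontier \<Omega>)"
    using has_derivative_sgn[OF jet2_onD(2)[OF rD(7,2)] rD(4)[OF rD(2)]]
    by (simp add: W \<nu> has_derivative_at_withinI)
  moreover have "sgn (gradient r x) = inner_normal \<Omega> x" if "x \<in> frontier \<Omega>" "x \<in> U" for x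
  proof -
    have "local_defining_function \<Omega> x U r"
      using r that by (simp add: local_defining_function_def)
    then show ?thesis using inner_normal_eq that by metis
  qed
  moreover obtain d where "d > 0" "ball p d \<subseteq> U" using rD(1,2) open_contains_ball by blast
  ultimately have N: "(inner_normal \<Omega> has_derivative (\<lambda>y. - W y)) (at p within frontier \<Omega>)"
    using has_derivative_transform_within[of "\<lambda>x. sgn (gradient r x)" "\<lambda>y. - W y" p "frontier \<Omega>" d "inner_normal \<Omega>"] p
    by (force simp: dist_commute)
  have "L v = - W v" if "(inner_normal \<Omega> has_derivative L) (at p within frontier \<Omega>)" "\<nu> \<bullet> v = 0" for L v
    using derivative_within_frontier_unique[OF r p _ that(1) N] that(2) by (simp add: \<nu>p inner_commute)
  then show ?thesis
    using N unfolding principal_space_def boundary_tangent_space_def \<nu>p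
    by (fastforce simp: inner_commute)
qed

text \<open>Each eigenspace is the span of the basis vectors with that eigenvalue, so its dimension
  counts them, and the sum over the basis groups by eigenvalue.\<close>

lemma eigenvalues_of_orthonormal_eigenbasis:
  fixes W :: "'a::euclidean_space \<Rightarrow> 'a"
  assumes W: "linear W" and V: "orthonormal V" and eig: "\<And>b. b \<in> V \<Longrightarrow> W b = (b \<bullet> W b) *\<^sub>R b"
    and E: "\<And>k. E k = {v \<in> span V. W v = k *\<^sub>R v}"
  shows "{k. \<exists>v\<in>E k. v \<noteq> 0} = (\<lambda>b. b \<bullet> W b) ` V"
    and "(\<Sum>k\<in>{k. \<exists>v\<in>E k. v \<noteq> 0}. real (dim (E k)) * k) = (\<Sum>b\<in>V. b \<bullet> W b)"
proof -
  let ?l = "\<lambda>b. b \<bullet> W b"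
  let ?V = "\<lambda>k. {b \<in> V. ?l b = k}"
  have Ek: "E k = span (?V k)" for k
  proof
    show "span (?V k) \<subseteq> E k"
    proof (rule span_minimal)
      show "?V k \<subseteq> E k" unfolding E using eig by (auto simp: span_base)
      show "subspace (E k)" unfolding E
        by (auto simp: subspace_def span_zero span_add span_scale linear_0[OF W] linear_add[OF W]
            linear_cmul[OF W] algebra_simps)
    qed
    show "E k \<subseteq> span (?V k)"
    proof
      fix v assume "v \<in> E k"
      then have v: "v \<in> span V" "W v = k *\<^sub>R v" by (auto simp: E)
      have ex: "v = (\<Sum>b\<in>V. (v \<bullet> b) *\<^sub>R b)" by (rule orthonormal_expand[OF V v(1)])
      have "(v \<bullet> b) *\<^sub>R b \<in> span (?V k)" if b: "b \<in> V" for b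
      proof -
        have "W v = (\<Sum>a\<in>V. (v \<bullet> a) *\<^sub>R W a)"
          by (subst ex) (simp add: linear_sum[OF W] linear_cmul[OF W])
        also have "\<dots> = (\<Sum>a\<in>V. ((v \<bullet> a) * ?l a) *\<^sub>R a)"
        proof (rule sum.cong[OF refl])
          fix a assume "a \<in> V"
          then show "(v \<bullet> a) *\<^sub>R W a = ((v \<bullet> a) * ?l a) *\<^sub>R a" by (subst eig) simp_all
        qed
        \<comment> \<open>Comparing the coefficients of \<open>b\<close> in
          \<open>W v = k v\<close>: a nonzero one forces \<open>b\<close> to have the eigenvalue
          \<open>k\<close>.\<close>
        finally have "W v \<bullet> b = (\<Sum>a\<in>V. if a = b then (v \<bullet> a) * ?l a else 0)"
          using b by (simp add: inner_sum_left orthonormal_inner[OF V] if_distrib cong: if_cong sum.cong)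
        then have "W v \<bullet> b = (v \<bullet> b) * ?l b" using b orthonormal_finite[OF V] by simp
        then have "k * (v \<bullet> b) = ?l b * (v \<bullet> b)" using v(2) by simp
        then have "v \<bullet> b = 0 \<or> b \<in> ?V k" using b by auto
        then show ?thesis using span_base[of b "?V k"] by (auto simp: span_zero span_scale)
      qed
      then show "v \<in> span (?V k)" by (subst ex) (rule span_sum)
    qed
  qed
  show eq: "{k. \<exists>v\<in>E k. v \<noteq> 0} = ?l ` V"
  proof
    show "{k. \<exists>v\<in>E k. v \<noteq> 0} \<subseteq> ?l ` V"
    proof
      fix k assume "k \<in> {k. \<exists>v\<in>E k. v \<noteq> 0}"
      then obtain v where "v \<in> span (?V k)" "v \<noteq> 0" unfolding Ek by blast
      then have "?V k \<noteq> {}" by (metis singletonD span_empty)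
      then show "k \<in> ?l ` V" by blast
    qed
    show "?l ` V \<subseteq> {k. \<exists>v\<in>E k. v \<noteq> 0}"
    proof
      fix k assume "k \<in> ?l ` V"
      then obtain b where b: "b \<in> ?V k" by blast
      then have "b \<noteq> 0" using V by (auto simp: orthonormal_def)
      then show "k \<in> {k. \<exists>v\<in>E k. v \<noteq> 0}" unfolding Ek using span_base[OF b] by blast
    qed
  qed
  have "dim (E k) = card (?V k)" for k
  proof -
    have "independent (?V k)" using orthonormal_independent[OF V] by (rule independent_mono) auto
    then show ?thesis unfolding Ek by (simp add: dim_eq_card_independent)
  qed
  then have "(\<Sum>k\<in>?l ` V. real (dim (E k)) * k) = (\<Sum>k\<in>?l ` V. \<Sum>b\<in>?V k. ?l b)"
    by simp
  also have "\<dots> = (\<Sum>b\<in>V. ?l b)"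
    using sum.image_gen[OF orthonormal_finite[OF V], of ?l ?l] by simp
  finally show "(\<Sum>k\<in>{k. \<exists>v\<in>E k. v \<noteq> 0}. real (dim (E k)) * k) = (\<Sum>b\<in>V. ?l b)"
    unfolding eq .
qed

text \<open>Shrinking the metric in a direction of positive principal curvature makes a boundary of zero
  mean curvature strictly mean concave.\<close>

lemma barrier_curvature_at_boundary_pos:
  assumes r: "local_defining_function \<Omega> p U r" and p: "p \<in> frontier \<Omega>"
    and nc: "boundary_not_convex_at \<Omega> p" and mc: "mean_curvature \<Omega> p = 0"
  obtains e where "norm e = 1"
    "\<And>c. c > 0 \<Longrightarrow> barrier_curvature (shrink e c) (gradient r p) (hess r p) > 0"
proof -
  note rD = local_defining_functionD[OF r]
  define g \<nu> l H where "g = gradient r p" and "\<nu> = sgn g" and "l = norm g" and "H = hess r p"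
  have l: "l > 0" using rD by (simp add: l_def g_def)
  have g: "g = l *\<^sub>R \<nu>" using l by (simp add: \<nu>_def l_def sgn_div_norm)
  have \<nu>: "norm \<nu> = 1" "\<nu> \<bullet> \<nu> = 1" using l by (simp_all add: \<nu>_def l_def norm_eq_1[symmetric] norm_sgn)
  have H: "linear H" by (simp add: H_def linear_hess)
  have Hsym: "v \<bullet> H w = H v \<bullet> w" for v w
    unfolding H_def
    using hessian_symmetric[OF rD(1,2) jet2_onD(1)[OF rD(7)] jet2_onD(2)[OF rD(7,2)]] .
  \<comment> \<open>The shape operator in terms of \<open>r\<close>, extended to all vectors with
    image in the tangent space \<open>T\<close>.\<close>
  define W where "W y = (- 1 / l) *\<^sub>R (H y - (\<nu> \<bullet> H y) *\<^sub>R \<nu>)" for y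
  define T where "T = {v. \<nu> \<bullet> v = 0}"
  have W: "linear W"
    by (rule linearI) (simp_all add: W_def linear_add[OF H] linear_cmul[OF H] inner_add_right algebra_simps)
  have T: "subspace T" by (simp add: T_def subspace_hyperplane)
  have WT: "W x \<in> T" for x by (simp add: W_def T_def inner_diff_right \<nu>)
  have inner_W: "v \<bullet> W w = (- 1 / l) * (v \<bullet> H w)" if "v \<in> T" for v w
    using that by (simp add: W_def T_def inner_diff_right inner_commute[of v \<nu>])
  have Wsym: "v \<bullet> W w = W v \<bullet> w" if "v \<in> T" "w \<in> T" for v w
    using inner_W[OF that(1), of w] inner_W[OF that(2), of v] Hsym[of v w]
    by (simp add: inner_commute[of "W v"] inner_commute[of "H v"])
  obtain V where V: "orthonormal V" "span V = T" and eig: "\<And>b. b \<in> V \<Longrightarrow> W b = (b \<bullet> W b) *\<^sub>R b"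
    using selfadjoint_eigenbasis[OF W T WT Wsym] by auto
  have VT: "b \<in> T" if "b \<in> V" for b using that V(2) span_base by blast
  have E: "principal_space \<Omega> p k = {v \<in> span V. W v = k *\<^sub>R v}" for k
    using principal_space_eq[OF r p, of \<nu> W k] V(2)
    by (simp add: \<nu>_def g_def W_def[abs_def] l_def H_def T_def)
  note ev = eigenvalues_of_orthonormal_eigenbasis[OF W V(1) eig E]
  have sum0: "(\<Sum>b\<in>V. b \<bullet> W b) = 0"
    using mc ev(2) by (simp add: mean_curvature_def principal_curvatures_def)
  obtain b where b: "b \<in> V" "b \<bullet> W b < 0"
    using nc ev(1) by (auto simp: boundary_not_convex_at_def principal_curvatures_def)
  \<comment> \<open>A zero sum with a negative term has a positive one; it provides the direction
    \<open>e\<close>.\<close>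
  have "\<exists>e\<in>V. e \<bullet> W e > 0"
  proof (rule ccontr)
    assume "\<not> (\<exists>e\<in>V. e \<bullet> W e > 0)"
    then have "\<forall>e\<in>V. - (e \<bullet> W e) = 0"
      using sum0 sum_nonneg_eq_0_iff[OF orthonormal_finite[OF V(1)], of "\<lambda>e. - (e \<bullet> W e)"]
      by (force simp: sum_negf not_less)
    then show False using b by force
  qed
  then obtain e where e: "e \<in> V" "e \<bullet> W e > 0" by blast
  have ne: "norm e = 1" using V(1) e by (simp add: orthonormal_def)
  have "\<nu> \<notin> V" using VT[of \<nu>] \<nu> by (auto simp: T_def)
  have "orthonormal (insert \<nu> V)"
    using V(1) \<nu> VT unfolding orthonormal_def
    by (auto simp: pairwise_insert orthogonal_def T_def inner_commute)
  moreover have "span (insert \<nu> V) = UNIV"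
  proof -
    have "y \<in> span (insert \<nu> V)" for y
    proof -
      have "y - (\<nu> \<bullet> y) *\<^sub>R \<nu> \<in> span V" by (simp add: V(2) T_def inner_diff_right \<nu>)
      then have "y - (\<nu> \<bullet> y) *\<^sub>R \<nu> \<in> span (insert \<nu> V)"
        using span_mono[of V "insert \<nu> V"] by blast
      moreover have "(\<nu> \<bullet> y) *\<^sub>R \<nu> \<in> span (insert \<nu> V)" by (simp add: span_base span_scale)
      ultimately show ?thesis using span_add by fastforce
    qed
    then show ?thesis by blast
  qed
  ultimately have "optrace H = (\<Sum>v\<in>insert \<nu> V. v \<bullet> H v)" using H by (intro optrace_orthonormal)
  also have "\<dots> = \<nu> \<bullet> H \<nu> + (\<Sum>v\<in>V. v \<bullet> H v)"
    using \<open>\<nu> \<notin> V\<close> orthonormal_finite[OF V(1)] by simp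
  \<comment> \<open>On tangent vectors the form of \<open>H\<close> is \<open>- l\<close> times that
    of the shape operator, so zero mean curvature leaves only the normal entry of the trace.\<close>
  also have "(\<Sum>v\<in>V. v \<bullet> H v) = (\<Sum>v\<in>V. - l * (v \<bullet> W v))"
    using l VT by (intro sum.cong) (auto simp: inner_W)
  also have "\<dots> = 0" using sum0 by (simp add: sum_negf sum_distrib_left[symmetric])
  finally have trH: "optrace H = \<nu> \<bullet> H \<nu>" by simp
  have eHe: "e \<bullet> H e = - l * (e \<bullet> W e)" using inner_W[OF VT[OF e(1)], of e] l by simp
  have "barrier_curvature (shrink e c) g H > 0" if "c > 0" for c
  proof -
    \<comment> \<open>\<open>shrink e c\<close> fixes the normal \<open>g\<close>, so only the trace
      term changes, by a positive multiple of the curvature in direction \<open>e\<close>.\<close>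
    have "e \<bullet> g = 0" using VT[OF e(1)] by (simp add: g T_def inner_commute)
    then have "shrink e c g = g" by (simp add: shrink_def)
    then have "barrier_curvature (shrink e c) g H
        = (g \<bullet> g) * (optrace H - c * (e \<bullet> H e)) - g \<bullet> H g"
      by (simp add: barrier_curvature_def optrace_shrink[OF H])
    also have "\<dots> = l^3 * c * (e \<bullet> W e)"
      unfolding trH eHe by (simp add: g linear_cmul[OF H] \<nu> power3_eq_cube algebra_simps)
    also have "\<dots> > 0" using l that e by simp
    finally show ?thesis .
  qed
  then show ?thesis using that ne by (simp add: g_def H_def)
qed

section \<open>Nonexistence\<close>

lemma shrink_bounds:
  assumes "norm e = 1" "0 \<le> c" "c \<le> 1"
  shows "0 \<le> y \<bullet> shrink e c y" "y \<bullet> shrink e c y \<le> y \<bullet> y"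
    "shrink e c y \<bullet> shrink e c y \<le> y \<bullet> shrink e c y"
proof -
  define a where "a = e \<bullet> y"
  have ee: "e \<bullet> e = 1" and ye: "y \<bullet> e = a" using assms(1) by (simp_all add: norm_eq_1 a_def inner_commute)
  show "0 \<le> y \<bullet> shrink e c y"
    using order_trans[OF _ shrink_lower_bound[OF assms(1,2), of y]] assms(3) by simp
  have 1: "y \<bullet> shrink e c y = y \<bullet> y - c * a^2"
    by (simp add: shrink_def inner_diff_right ye a_def[symmetric] power2_eq_square)
  then show "y \<bullet> shrink e c y \<le> y \<bullet> y" using assms(2) by simp
  have "shrink e c y \<bullet> shrink e c y = y \<bullet> y - 2 * c * a^2 + c * (c * a^2)"
    by (simp add: shrink_def inner_diff_right inner_diff_left ye ee a_def[symmetric] power2_eq_square algebra_simps)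
  moreover have "c * (c * a^2) \<le> 1 * (c * a^2)" using assms by (intro mult_right_mono) auto
  ultimately show "shrink e c y \<bullet> shrink e c y \<le> y \<bullet> shrink e c y" using 1 by simp
qed

lemma exists_large_square:
  fixes E X :: real
  assumes "E > 0"
  obtains C where "C > 0" "C^2 * E > X"
proof -
  define C where "C = max 1 (X / E + 1)"
  have C: "C \<ge> 1" "C > X / E" by (auto simp: C_def)
  then have "X < C * E" using assms by (simp add: pos_divide_less_eq)
  also have "\<dots> \<le> C^2 * E" using C assms self_le_power[of C 2] by (intro mult_right_mono) auto
  finally show ?thesis using that[of C] C by simp
qed

text \<open>The scalar minimal surface equation for the flat metric inverse to \<open>B\<close>. The
  jet is quantified away so that the bounds below can fix their constants before the
  function.\<close>

definition minimal_on :: "('a::euclidean_space \<Rightarrow> 'a) \<Rightarrow> 'a set \<Rightarrow> ('a \<Rightarrow> real) \<Rightarrow> bool"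
  where "minimal_on B \<Omega> u \<longleftrightarrow> (\<exists>g H. jet2_on \<Omega> u g H \<and> (\<forall>x\<in>\<Omega>. minop B (g x) (H x) = 0))"

text \<open>Barrier built on half the squared distance to \<open>q\<close>, with infinite slope on
  the sphere of radius \<open>\<rho>\<close>; hence boundary values inside that sphere do not
  enter.\<close>

lemma bound_away_from_point:
  fixes \<Omega> :: "'a::euclidean_space set"
  assumes \<Omega>: "open \<Omega>" "bounded \<Omega>" and e: "norm e = 1" and c: "0 \<le> c" "c < 1"
    and \<rho>: "\<rho> > 0" and dim: "DIM('a) \<ge> 3"
  obtains A where "\<forall>u m. continuous_on (closure \<Omega>) u \<and> minimal_on (shrink e c) \<Omega> u \<and>
      (\<forall>x\<in>frontier \<Omega>. \<rho> \<le> dist q x \<longrightarrow> u x \<le> m) \<longrightarrow>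
      (\<forall>x\<in>closure \<Omega>. \<rho> \<le> dist q x \<longrightarrow> u x \<le> m + A)"
proof -
  define B where "B = shrink e c"
  note sb = shrink_bounds[OF e c(1) less_imp_le[OF c(2)], folded B_def]
  have comp: "compact (closure \<Omega>)" using \<Omega> by (simp add: compact_closure)
  obtain D where D: "D > 0" "\<And>x. x \<in> closure \<Omega> \<Longrightarrow> dist q x \<le> D"
    using bounded_any_center[of "closure \<Omega>" q] compact_imp_bounded[OF comp]
    by (metis dual_order.trans less_eq_real_def linorder_not_less zero_less_one)
  define s where "s x = (x - q) \<bullet> (x - q) / 2" for x
  have s: "s x = (dist q x)^2 / 2" for x
    by (simp add: s_def dist_norm norm_minus_commute power2_norm_eq_inner[symmetric])
  have js: "jet2_on \<Omega> s (\<lambda>x. x - q) (\<lambda>x y. y)"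
    unfolding jet2_on_def s_def
    by (auto intro!: derivative_eq_intros simp: inner_commute fun_eq_iff)
  define n where "n = real DIM('a)"
  have n: "n \<ge> 3" using dim by (simp add: n_def)
  have tr: "optrace (\<lambda>y. B y) = n - c"
    using optrace_shrink[OF linear_ident, of e c] e by (simp add: B_def optrace_id n_def norm_eq_1)
  define E0 where "E0 = (1 - c) * \<rho>^2"
  have E0: "E0 > 0" using c \<rho> by (simp add: E0_def)
  obtain C where C: "C > 0" "C^2 * E0 > 2 * D^2 + 4 * (D^2 / 2) * n"
    using exists_large_square[OF E0] by blast
  define K where "K = closure \<Omega> \<inter> {x. \<rho> \<le> dist q x}"
  have "closed {x. \<rho> \<le> dist q x}" by (intro closed_Collect_le continuous_intros)
  then have K: "compact K" unfolding K_def by (intro compact_Int_closed comp)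
  have sK: "s x \<ge> \<rho>^2 / 2 \<longleftrightarrow> \<rho> \<le> dist q x" for x
    using \<rho> power_mono_iff[of \<rho> "dist q x" 2] by (simp add: s)
  show ?thesis
  proof (rule that, intro allI impI ballI)
    fix u m x
    assume u: "continuous_on (closure \<Omega>) u \<and> minimal_on (shrink e c) \<Omega> u \<and>
        (\<forall>x\<in>frontier \<Omega>. \<rho> \<le> dist q x \<longrightarrow> u x \<le> m)"
      and x: "x \<in> closure \<Omega>" "\<rho> \<le> dist q x"
    from u have cu: "continuous_on (closure \<Omega>) u"
      and m: "\<And>x. x \<in> frontier \<Omega> \<Longrightarrow> \<rho> \<le> dist q x \<Longrightarrow> u x \<le> m" by auto
    from u obtain gu Hu where ju: "jet2_on \<Omega> u gu Hu"
      and eq: "\<And>x. x \<in> \<Omega> \<Longrightarrow> minop (shrink e c) (gu x) (Hu x) = 0"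
      by (auto simp: minimal_on_def)
    show "u x \<le> m + C * sqrt (D^2 / 2)"
    proof (rule barrier_bound[of B K \<Omega> "\<rho>^2 / 2" s u gu Hu "\<lambda>x. x - q" "\<lambda>x y. y", OF _ _ _ K \<Omega>(1) _ _ _ ju js])
      show "linear B" by (simp add: B_def linear_shrink)
      show "v \<bullet> B w = B v \<bullet> w" for v w by (simp add: B_def shrink_symmetric)
      show "v \<bullet> B v \<ge> 0" for v by (rule sb)
      show "K \<inter> \<Omega> = {x \<in> \<Omega>. \<rho>^2 / 2 \<le> s x}" unfolding K_def sK using closure_subset[of \<Omega>] by blast
      show "continuous_on K u" using cu by (rule continuous_on_subset) (auto simp: K_def)
      show "continuous_on K s" unfolding s_def by (intro continuous_intros) auto
      show "minop B (gu x) (Hu x) = 0" if "x \<in> \<Omega>" for x using eq[OF that] by (simp add: B_def)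
      show "\<rho>^2 / 2 \<le> s x \<and> s x \<le> \<rho>^2 / 2 + D^2 / 2" if "x \<in> K" for x
      proof -
        have "(dist q x)^2 \<le> D^2" using that D by (intro power_mono) (auto simp: K_def)
        then have "s x \<le> D^2 / 2" by (simp add: s)
        moreover have "\<rho>^2 / 2 \<ge> 0" by simp
        moreover have "\<rho>^2 / 2 \<le> s x" unfolding sK using that by (simp add: K_def)
        ultimately show ?thesis by linarith
      qed
      show "u x \<le> m" if "x \<in> K" "x \<notin> \<Omega>" for x
        using that \<Omega> by (intro m) (auto simp: K_def frontier_def interior_open)
      show "E0 \<le> barrier_curvature B (x - q) (\<lambda>y. y)" if "x \<in> K" "x \<in> \<Omega>" for x
      proof -
        let ?y = "x - q"
        have "\<rho>^2 \<le> ?y \<bullet> ?y" using that sK[of x] by (simp add: K_def s_def)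
        then have "E0 \<le> (1 - c) * (?y \<bullet> ?y)" unfolding E0_def using c by (intro mult_left_mono) auto
        also have "\<dots> \<le> ?y \<bullet> B ?y" unfolding B_def by (rule shrink_lower_bound[OF e c(1)])
        \<comment> \<open>The trace of \<open>B\<close> is \<open>n - c\<close>, and one unit of it
          absorbs the term \<open>B ?y \<bullet> B ?y\<close>. In dimension at least 3 with
          \<open>c < 1\<close>, more than 1 is left.\<close>
        also have "\<dots> \<le> (?y \<bullet> B ?y) * (n - c - 1)"
          using mult_left_mono[of 1 "n - c - 1" "?y \<bullet> B ?y"] sb(1) n c by simp
        also have "\<dots> \<le> barrier_curvature B ?y (\<lambda>y. y)"
          using sb(3)[of ?y] by (simp add: barrier_curvature_def tr algebra_simps)
        finally show ?thesis .
      qed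
      show "E0 > 0" by (rule E0)
      show "(x - q) \<bullet> B (x - q) \<le> D^2" if "x \<in> K" "x \<in> \<Omega>" for x
      proof -
        have "(dist q x)^2 \<le> D^2" using that D by (intro power_mono) (auto simp: K_def)
        then have "(x - q) \<bullet> (x - q) \<le> D^2"
          by (simp add: dist_norm norm_minus_commute power2_norm_eq_inner[symmetric])
        then show ?thesis using sb(2)[of "x - q"] by linarith
      qed
      show "\<bar>optrace (\<lambda>y. B y)\<bar> \<le> n" using n c by (simp add: tr)
      show "C > 0" "2 * D^2 + 4 * (D^2 / 2) * n < C^2 * E0" by (rule C)+
      show "x \<in> K" using x by (simp add: K_def)
    qed
  qed
qed

text \<open>Barrier built on the defining function, whose \<open>barrier_curvature\<close> stays
  positive near \<open>q\<close> by continuity. Its infinite slope lies on a level set inside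
  \<open>\<Omega>\<close>, so that no boundary values enter.\<close>

lemma bound_near_boundary_point:
  fixes \<Omega> :: "(real^'n::finite) set"
  assumes \<Omega>: "open \<Omega>" and e: "norm e = 1" and c: "0 \<le> c" "c < 1"
    and r: "local_defining_function \<Omega> q U r"
    and pos: "barrier_curvature (shrink e c) (gradient r q) (hess r q) > 0"
  obtains \<rho> A where "\<rho> > 0" "\<forall>u m. minimal_on (shrink e c) \<Omega> u \<and>
      (\<forall>x\<in>\<Omega>. dist q x = \<rho> \<longrightarrow> u x \<le> m) \<longrightarrow> (\<forall>x\<in>\<Omega>. dist q x \<le> \<rho> \<longrightarrow> u x \<le> m + A)"
proof -
  note rD = local_defining_functionD[OF r]
  define B where "B = shrink e c"
  note sb = shrink_bounds[OF e c(1) less_imp_le[OF c(2)], folded B_def]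
  have cg: "continuous_on U (gradient r)" by (rule continuous_on_gradient[OF rD(1,3)])
  have cB: "continuous_on U (\<lambda>x. B (v x))" if "continuous_on U v" for v
    using that unfolding B_def shrink_def by (intro continuous_intros)
  have cr: "continuous_on U r"
    using jet2_onD(1)[OF rD(7)] by (intro continuous_at_imp_continuous_on ballI has_derivative_continuous)
  define N where "N x = gradient r x \<bullet> B (gradient r x)" for x
  define T where "T x = optrace (\<lambda>y. B (hess r x y))" for x
  define E where "E x = barrier_curvature B (gradient r x) (hess r x)" for x
  have cN: "continuous_on U N" unfolding N_def by (intro continuous_intros cg cB)
  have cT: "continuous_on U T" unfolding T_def optrace_def
    by (intro continuous_intros cB continuous_on_hess[OF rD(3)])
  have "E x = N x * T x - B (gradient r x) \<bullet> hess r x (B (gradient r x))" for x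
    by (simp add: E_def barrier_curvature_def N_def T_def)
  moreover have "continuous_on U (\<lambda>x. N x * T x - B (gradient r x) \<bullet> hess r x (B (gradient r x)))"
    by (intro continuous_intros cN cT cB cg continuous_on_hess[OF rD(3)])
  ultimately have cE: "continuous_on U E" by (simp cong: continuous_on_cong)
  define E0 where "E0 = E q / 2"
  have E0: "E0 > 0" "E0 < E q" using pos by (auto simp: E0_def E_def B_def)
  have "open (U \<inter> E -` {E0<..})" using cE rD(1) by (intro continuous_open_preimage) auto
  moreover have "q \<in> U \<inter> E -` {E0<..}" using rD(2) E0 by simp
  ultimately obtain \<rho> where \<rho>: "\<rho> > 0" "cball q \<rho> \<subseteq> U \<inter> E -` {E0<..}"
    using open_contains_cball by metis
  have bd: "\<exists>b. \<forall>x\<in>cball q \<rho>. \<bar>f x\<bar> \<le> b" if "continuous_on U f" for f :: "_ \<Rightarrow> real"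
  proof -
    have "continuous_on (cball q \<rho>) f" using that \<rho> by (intro continuous_on_subset[OF that]) auto
    then have "bounded (f ` cball q \<rho>)"
      using compact_cball by (intro compact_imp_bounded compact_continuous_image)
    then show ?thesis by (auto simp: bounded_iff)
  qed
  obtain N0 where N0: "\<And>x. x \<in> cball q \<rho> \<Longrightarrow> \<bar>N x\<bar> \<le> N0" using bd[OF cN] by blast
  obtain T0 where T0: "\<And>x. x \<in> cball q \<rho> \<Longrightarrow> \<bar>T x\<bar> \<le> T0" using bd[OF cT] by blast
  obtain R where R: "\<And>x. x \<in> cball q \<rho> \<Longrightarrow> \<bar>r x\<bar> \<le> R" using bd[OF cr] by blast
  obtain C where C: "C > 0" "C^2 * E0 > 2 * N0 + 4 * R * T0"
    using exists_large_square[OF E0(1)] by blast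
  show ?thesis
  proof (rule that[OF \<rho>(1)], intro allI impI ballI)
    fix u m x
    assume u: "minimal_on (shrink e c) \<Omega> u \<and> (\<forall>x\<in>\<Omega>. dist q x = \<rho> \<longrightarrow> u x \<le> m)"
      and x: "x \<in> \<Omega>" "dist q x \<le> \<rho>"
    from u have m: "\<And>x. x \<in> \<Omega> \<Longrightarrow> dist q x = \<rho> \<Longrightarrow> u x \<le> m" by auto
    from u obtain gu Hu where ju: "jet2_on \<Omega> u gu Hu"
      and eq: "\<And>x. x \<in> \<Omega> \<Longrightarrow> minop (shrink e c) (gu x) (Hu x) = 0"
      by (auto simp: minimal_on_def)
    \<comment> \<open>The comparison starts at the level set through \<open>x\<close> itself, which
      avoids the boundary; the constants depend only on bounds over the closed ball, not on
      \<open>\<delta>\<close>.\<close>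
    define \<delta> where "\<delta> = r x"
    have xU: "x \<in> U" using x \<rho> by auto
    have \<delta>: "\<delta> > 0" using x rD(5)[OF xU] by (simp add: \<delta>_def)
    define K where "K = cball q \<rho> \<inter> {x \<in> U. \<delta> \<le> r x}"
    define G where "G = \<Omega> \<inter> ball q \<rho>"
    have KU: "K \<subseteq> U" by (auto simp: K_def)
    \<comment> \<open>Consequently the points of \<open>K\<close> outside \<open>G\<close> lie on
      the sphere of radius \<open>\<rho>\<close>, where \<open>m\<close> bounds
      \<open>u\<close>.\<close>
    have K\<Omega>: "K \<subseteq> \<Omega>" using \<delta> rD(5) by (force simp: K_def)
    have GU: "G \<subseteq> U" using \<rho> by (auto simp: G_def)
    show "u x \<le> m + C * sqrt R"
    proof (rule barrier_bound[of B K G \<delta> r u gu Hu "gradient r" "hess r"])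
      show "linear B" by (simp add: B_def linear_shrink)
      show "v \<bullet> B w = B v \<bullet> w" for v w by (simp add: B_def shrink_symmetric)
      show "v \<bullet> B v \<ge> 0" for v by (rule sb)
      have "K = {x \<in> cball q \<rho>. \<delta> \<le> r x}" using \<rho> by (auto simp: K_def)
      moreover have "closed {x \<in> cball q \<rho>. \<delta> \<le> r x}"
        using \<rho> by (intro continuous_on_closed_Collect_le continuous_on_subset[OF cr]) auto
      ultimately show "compact K" by (auto simp: compact_eq_bounded_closed intro: bounded_subset[OF bounded_cball])
      show "open G" using \<Omega> by (simp add: G_def open_Int)
      show "K \<inter> G = {x \<in> G. \<delta> \<le> r x}" using GU by (auto simp: K_def G_def)
      show "continuous_on K u"
        using jet2_onD(1)[OF ju] K\<Omega>
        by (intro continuous_at_imp_continuous_on ballI) (blast intro: has_derivative_continuous)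
      show "continuous_on K r" by (rule continuous_on_subset[OF cr KU])
      show "jet2_on G u gu Hu" by (rule jet2_on_subset[OF ju]) (auto simp: G_def)
      show "jet2_on G r (gradient r) (hess r)" by (rule jet2_on_subset[OF rD(7) GU])
      show "minop B (gu x) (Hu x) = 0" if "x \<in> G" for x using eq that by (simp add: B_def G_def)
      show "\<delta> \<le> r x \<and> r x \<le> \<delta> + R" if "x \<in> K" for x
        using R[of x] that \<delta> by (auto simp: K_def)
      show "u x \<le> m" if "x \<in> K" "x \<notin> G" for x
        using that K\<Omega> by (intro m) (auto simp: K_def G_def)
      show "E0 \<le> barrier_curvature B (gradient r x) (hess r x)" if "x \<in> K" for x
        using that \<rho>(2) by (force simp: K_def E_def)
      show "E0 > 0" by (rule E0)
      show "gradient r x \<bullet> B (gradient r x) \<le> N0" if "x \<in> K" for x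
        using that N0[of x] by (auto simp: K_def N_def)
      show "\<bar>optrace (\<lambda>y. B (hess r x y))\<bar> \<le> T0" if "x \<in> K" for x
        using that T0[of x] by (auto simp: K_def T_def)
      show "C > 0" "2 * N0 + 4 * R * T0 < C^2 * E0" by (rule C)+
      show "x \<in> K" using x xU by (simp add: K_def \<delta>_def)
    qed
  qed
qed

section \<open>Boundary data and conclusion\<close>

lemma quadratic_map_C2_closure:
  fixes a q :: "real^'n::finite" and v w :: "'b::real_normed_vector"
  shows "C2_closure \<Omega> (\<lambda>x. (a \<bullet> x) *\<^sub>R v + ((x - q) \<bullet> (x - q)) *\<^sub>R w)"
proof -
  let ?f = "\<lambda>x. (a \<bullet> x) *\<^sub>R v + ((x - q) \<bullet> (x - q)) *\<^sub>R w"
  have f': "(?f has_derivative (\<lambda>y. (a \<bullet> y) *\<^sub>R v + (2 * ((x - q) \<bullet> y)) *\<^sub>R w)) (at x)" for x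
    by (auto intro!: derivative_eq_intros simp: fun_eq_iff inner_commute)
  have 1: "partial_deriv i ?f = (\<lambda>x. (a $ i) *\<^sub>R v + (2 * x $ i - 2 * q $ i) *\<^sub>R w)" for i
    using partial_deriv_eq[OF f'] by (auto simp: fun_eq_iff inner_axis)
  have f'': "((\<lambda>x. (a $ i) *\<^sub>R v + (2 * x $ i - 2 * q $ i) *\<^sub>R w) has_derivative (\<lambda>y. (2 * y $ i) *\<^sub>R w)) (at x)" for i x
    by (auto intro!: derivative_eq_intros bounded_linear.has_derivative[OF bounded_linear_vec_nth])
  have 2: "partial_deriv j (\<lambda>x. (a $ i) *\<^sub>R v + (2 * x $ i - 2 * q $ i) *\<^sub>R w) = (\<lambda>x. (2 * (axis j 1 :: real^'n) $ i) *\<^sub>R w)" for i j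
    using partial_deriv_eq[OF f''] by (auto simp: fun_eq_iff)
  have "?f differentiable_on \<Omega>" "\<And>i. (\<lambda>x. (a $ i) *\<^sub>R v + (2 * x $ i - 2 * q $ i) *\<^sub>R w) differentiable_on \<Omega>"
    unfolding differentiable_on_def differentiable_def
    using has_derivative_at_withinI[OF f'] has_derivative_at_withinI[OF f''] by blast+
  then have "Ck_on 2 \<Omega> ?f" by (simp add: numeral_2_eq_2 1 2)
  have ext: "extends_continuously \<Omega> f" if "continuous_on (closure \<Omega>) f" for f :: "real^'n \<Rightarrow> 'b"
    using that unfolding extends_continuously_def by blast
  have "extends_continuously \<Omega> (\<lambda>x. (a $ i) *\<^sub>R v + (2 * x $ i - 2 * q $ i) *\<^sub>R w)"
    "extends_continuously \<Omega> (\<lambda>x. (2 * (axis j 1 :: real^'n) $ i) *\<^sub>R w)" for i j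
    by (rule ext, intro continuous_intros)+
  with \<open>Ck_on 2 \<Omega> ?f\<close> show ?thesis
    unfolding C2_closure_def 1 2 by (auto intro!: continuous_intros)
qed

theorem theorem7p1:
  fixes \<Omega> :: "(real^'n::finite) set" and q :: "real^'n"
  assumes "CARD('n) \<ge> 3"
    and "open \<Omega>" and "connected \<Omega>" and "bounded \<Omega>"
    and "smooth_boundary \<Omega>" and "mean_convex_boundary \<Omega>"
    and "q \<in> frontier \<Omega>"
    and "boundary_not_convex_at \<Omega> q"
    and "mean_curvature \<Omega> q = 0"
  shows "\<forall>\<epsilon>::real. 0 < \<epsilon> \<and> \<epsilon> \<le> 1 \<longrightarrow>
    (\<exists>\<psi> :: real^'n \<Rightarrow> real^2.
       C2_closure \<Omega> \<psi> \<and>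
       (\<forall>x\<in>\<Omega>. norm (gradient (\<lambda>y. \<psi> y $ 1) x) \<le> \<epsilon>) \<and>
       \<not> (\<exists>u. classical_solution \<Omega> \<psi> u))"
proof (intro allI impI)
  fix \<epsilon> :: real assume \<epsilon>: "0 < \<epsilon> \<and> \<epsilon> \<le> 1"
  note \<Omega> = \<open>open \<Omega>\<close> \<open>bounded \<Omega>\<close> and q = \<open>q \<in> frontier \<Omega>\<close>
  obtain U r where r: "local_defining_function \<Omega> q U r"
    using assms(5) q by (auto simp: smooth_boundary_def)
  obtain e where e: "norm e = 1"
    and pos: "\<And>c. c > 0 \<Longrightarrow> barrier_curvature (shrink e c) (gradient r q) (hess r q) > 0"
    using barrier_curvature_at_boundary_pos[OF r q assms(8,9)] by blast
  define c where "c = \<epsilon>^2 / (1 + \<epsilon>^2)"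
  have "1 + \<epsilon>^2 > 0" by (simp add: add_pos_nonneg)
  then have c: "0 < c" "c < 1" using \<epsilon> by (auto simp: c_def)
  obtain \<rho> A where \<rho>: "\<rho> > 0" and near: "\<forall>u m. minimal_on (shrink e c) \<Omega> u \<and>
      (\<forall>x\<in>\<Omega>. dist q x = \<rho> \<longrightarrow> u x \<le> m) \<longrightarrow> (\<forall>x\<in>\<Omega>. dist q x \<le> \<rho> \<longrightarrow> u x \<le> m + A)"
    using bound_near_boundary_point[OF \<Omega>(1) e less_imp_le[OF c(1)] c(2) r pos[OF c(1)]] by blast
  have "DIM(real^'n) \<ge> 3" using assms(1) by simp
  then obtain A' where away: "\<forall>u m. continuous_on (closure \<Omega>) u \<and> minimal_on (shrink e c) \<Omega> u \<and>
      (\<forall>x\<in>frontier \<Omega>. \<rho> \<le> dist q x \<longrightarrow> u x \<le> m) \<longrightarrow>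
      (\<forall>x\<in>closure \<Omega>. \<rho> \<le> dist q x \<longrightarrow> u x \<le> m + A')"
    using bound_away_from_point[OF \<Omega> e less_imp_le[OF c(1)] c(2) \<rho>] by blast
  \<comment> \<open>\<open>\<rho>\<close>, \<open>A\<close> and \<open>A'\<close> are fixed before
    the boundary data, so the drop \<open>k * \<rho>^2\<close> can be made to outweigh both
    constants.\<close>
  define k where "k = (\<bar>A\<bar> + \<bar>A'\<bar> + 1) / \<rho>^2"
  have k: "k \<ge> 0" "k * \<rho>^2 = \<bar>A\<bar> + \<bar>A'\<bar> + 1" using \<rho> by (auto simp: k_def)
  define \<psi> :: "real^'n \<Rightarrow> real^2"
    where "\<psi> x = ((\<epsilon> *\<^sub>R e) \<bullet> x) *\<^sub>R axis 1 1 + ((x - q) \<bullet> (x - q)) *\<^sub>R axis 2 (- k)" for x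
  have \<psi>1: "\<psi> x $ 1 = (\<epsilon> *\<^sub>R e) \<bullet> x" and \<psi>2: "\<psi> x $ 2 = - k * (dist q x)^2" for x
    by (simp_all add: \<psi>_def axis_def dist_norm norm_minus_commute power2_norm_eq_inner[symmetric])
  have "\<not> classical_solution \<Omega> \<psi> u" for u
  proof
    assume u: "classical_solution \<Omega> \<psi> u"
    note s = solution_component[OF \<Omega>(1) u, where a = 2]
    \<comment> \<open>The first component is forced to be linear, which freezes its share of the
      metric and leaves a scalar equation for the second.\<close>
    have eq: "minop (shrink e c) (gradient (\<lambda>x. u x $ 2) x) (hess (\<lambda>x. u x $ 2) x) = 0" if "x \<in> \<Omega>" for x
      unfolding c_def using solution_component_linear[OF \<Omega> u \<psi>1 that]
      by (intro second_component_equation[OF \<Omega>(1) u that _ e])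
    have min: "minimal_on (shrink e c) \<Omega> (\<lambda>x. u x $ 2)"
      unfolding minimal_on_def using s(1) eq by blast
    have "u y $ 2 \<le> - k * \<rho>^2" if "y \<in> frontier \<Omega>" "\<rho> \<le> dist q y" for y
    proof -
      have "k * \<rho>^2 \<le> k * (dist q y)^2"
        using that k(1) \<rho> by (intro mult_left_mono power_mono) auto
      then show ?thesis by (simp add: s(4)[OF that(1)] \<psi>2)
    qed
    then have "\<forall>x\<in>closure \<Omega>. \<rho> \<le> dist q x \<longrightarrow> u x $ 2 \<le> - k * \<rho>^2 + A'"
      using away s(2) min by blast
    then have "\<forall>x\<in>\<Omega>. dist q x = \<rho> \<longrightarrow> u x $ 2 \<le> - k * \<rho>^2 + A'"
      using closure_subset[of \<Omega>] by auto
    then have near': "\<forall>x\<in>\<Omega>. dist q x \<le> \<rho> \<longrightarrow> u x $ 2 \<le> - k * \<rho>^2 + A' + A"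
      using near min by blast
    define b where "b = - k * \<rho>^2 + A' + A"
    have le: "u x $ 2 \<le> b" if "x \<in> \<Omega> \<inter> ball q \<rho>" for x
      unfolding b_def using that near' by auto
    have qc: "q \<in> closure \<Omega>" using q by (simp add: frontier_def)
    \<comment> \<open>The bound holds inside \<open>\<Omega>\<close>; continuity up to the boundary
      carries it to \<open>q\<close>.\<close>
    have "q \<in> closure (\<Omega> \<inter> ball q \<rho>)"
      using qc \<rho> open_Int_closure_subset[OF open_ball, of q \<rho> \<Omega>] by (auto simp: Int_commute)
    moreover have "continuous_on (closure (\<Omega> \<inter> ball q \<rho>)) (\<lambda>x. u x $ 2)"
      using s(2) closure_mono[of "\<Omega> \<inter> ball q \<rho>" \<Omega>] by (auto intro: continuous_on_subset)
    ultimately have "u q $ 2 \<le> b"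
      using continuous_le_on_closure[of "\<Omega> \<inter> ball q \<rho>" "\<lambda>x. u x $ 2" q b] le by blast
    moreover have "u q $ 2 = 0" using s(4)[OF q] by (simp add: \<psi>2)
    \<comment> \<open>\<open>b \<le> -1\<close> by the choice of \<open>k\<close>, whereas the
      prescribed value at \<open>q\<close> is 0.\<close>
    ultimately show False using k by (simp add: b_def)
  qed
  moreover have "C2_closure \<Omega> \<psi>"
    unfolding \<psi>_def[abs_def] by (rule quadratic_map_C2_closure)
  moreover have "gradient (\<lambda>y. \<psi> y $ 1) x = \<epsilon> *\<^sub>R e" for x
    unfolding \<psi>1 by (rule gradient_eq) (auto intro!: derivative_eq_intros)
  ultimately show "\<exists>\<psi> :: real^'n \<Rightarrow> real^2. C2_closure \<Omega> \<psi> \<and>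
       (\<forall>x\<in>\<Omega>. norm (gradient (\<lambda>y. \<psi> y $ 1) x) \<le> \<epsilon>) \<and> \<not> (\<exists>u. classical_solution \<Omega> \<psi> u)"
    using e \<epsilon> by (intro exI[of _ \<psi>]) auto
qed

end
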